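(* Let $p$ be an odd prime, let $\sigma\subset\mathbb{C}_p$ be compact and let $\mu,\nu\in\mathbf{L}^*(\sigma)$. For $\lambda\in\mathbb{C}_p$ with $|\lambda|_p$ sufficiently large and $\lambda+x$ avoiding zero (for $x\in\sigma$), $$\log\Gamma_p^\mu(\lambda)=\int_\sigma(\lambda+x)\bigl(\log_p(\lambda+x)-1\bigr)\,d\mu(x),$$ and, in the fermionic case, $$\log\Gamma_{p,E}^\nu(\lambda)=-\int_\sigma(\lambda+x)\log_p(\lambda+x)\,d\nu(x).$$ Here $$\log\Gamma_p^\mu(\lambda)=\omega_v(\lambda)\frac{\partial}{\partial s}\zeta_p^\mu(s,\lambda)\Big|_{s=0},\qquad \log\Gamma_{p,E}^\nu(\lambda)=\omega_v(\lambda)\frac{\partial}{\partial s}\zeta_{p,E}^\nu(s,\lambda)\Big|_{s=0},$$ with $\zeta_p^\mu(s,\lambda)=\frac{1}{s-1}\int_\sigma\langle\lambda+x\rangle^{1-s}\,d\mu(x)$ for $s\in\mathbb{Z}_p\setminus\{1\}$ and $\zeta_{p,E}^\nu(s,\lambda)=\int_\sigma\langle\lambda+x\rangle^{1-s}\,d\nu(x)$ for $s\in\mathbb{Z}_p$.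
   Context: Notation. $\mathbb{C}_p$ is the completion of an algebraic closure of $\mathbb{Q}_p$, $|p|_p=p^{-1}$, $v_p$ is the additive valuation with $v_p(p)=1$. Fix a compatible system of fractional powers $p^r\in\mathbb{C}_p$, $r\in\mathbb{Q}$ (with $p^{r+r'}=p^rp^{r'}$ and $p^1=p$). For $a\in\mathbb{C}_p^\times$ write $a=p^{v_p(a)}u$ with $|u|_p=1$, let $\hat a=\lim_{n\to\infty}u^{p^{n!}}$ (the root of unity of order prime to $p$ with $|\hat a-u|_p<1$), and put $\omega_v(a)=p^{v_p(a)}\hat a$ and $\langle a\rangle=a/\omega_v(a)$, so $|\langle a\rangle-1|_p<1$. For $s\in\mathbb{Z}_p$, $\langle a\rangle^s=\sum_{n\ge0}\binom{s}{n}(\langle a\rangle-1)^n$. $\log_p:\mathbb{C}_p^\times\to\mathbb{C}_p$ is the Iwasawa logarithm: the homomorphism given by the usual series on $\{|x-1|_p<1\}$ and with $\log_p p=0$; it vanishes on roots of unity and on all $p^r$, so $\log_p a=\log_p\langle a\rangle$. Locally analytic functions and generalized distributions. For compact $\sigma\subset\mathbb{C}_p$ and $r>0$ let $D_a(r)=\{z\in\mathbb{C}_p:|z-a|_p<r\}$ and $\mathbb{D}_\sigma(r)=\bigcup_{a\in\sigma}D_a(r)$. $B_r(\sigma)$ is the Banach space of functions $f$ on $\mathbb{D}_\sigma(r)$ given by a convergent power series on each $D_a(r)$, $a\in\sigma$, with finite norm $\|f\|_r=\sup_{z\in\mathbb{D}_\sigma(r)}|f(z)|_p$. $\mathbf{L}(\sigma)$,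 the space of locally analytic functions on $\sigma$, is the union (inductive limit over $r\to0$, functions being identified if they agree on some $\mathbb{D}_\sigma(r')$) of the $B_r(\sigma)$, with the inductive limit topology. $\mathbf{L}^*(\sigma)$ is the space of continuous $\mathbb{C}_p$-linear maps $\mathbf{L}(\sigma)\to\mathbb{C}_p$ (generalized distributions); one writes $\int_\sigma f\,d\mu=\mu(f)$. *)

theory Defs
  imports "HOL-Analysis.Analysis" "HOL-Computational_Algebra.Computational_Algebra"
begin

text \<open>The library's \<open>norm\<close> is only usable on real normed spaces, so the absolute value gets its own name.\<close>

class complete_nonarch_field = field_char_0 + complete_space +
  fixes vabs :: "'a \<Rightarrow> real"
  assumes dist_vabs: "dist x y = vabs (x - y)"
    and vabs_mult: "vabs (x * y) = vabs x * vabs y"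
    and vabs_add: "vabs (x + y) \<le> max (vabs x) (vabs y)"


text \<open>Inside a field that contains \<open>\<rat>\<close> with its \<open>p\<close>-adic absolute value and is complete, the
  topological closures of \<open>\<rat>\<close> and \<open>\<int>\<close> are their completions.\<close>

definition Qp :: "'c::complete_nonarch_field set" where
  "Qp = closure \<rat>"

definition Zp :: "'c::complete_nonarch_field set" where
  "Zp = closure \<int>"

definition Qp_bar :: "'c::complete_nonarch_field set" where
  "Qp_bar = {x. \<exists>q. q \<noteq> 0 \<and> (\<forall>i. coeff q i \<in> Qp) \<and> poly q x = 0}"

text \<open>\<open>is_Cp p TYPE('c)\<close>: the complete field \<open>'c\<close> is a completion of an algebraic closure of the
  \<open>p\<close>-adic numbers, with the absolute value normalised by \<open>|p| = 1/p\<close> (for prime \<open>p\<close>, this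
  determines the absolute value on \<open>\<rat>\<close>). These conditions determine \<open>'c\<close> up to isometric
  isomorphism of fields.\<close>

definition is_Cp :: "nat \<Rightarrow> 'c::complete_nonarch_field itself \<Rightarrow> bool" where
  "is_Cp p _ \<longleftrightarrow>
     vabs (of_nat p :: 'c) = 1 / real p \<and>
     (\<forall>q :: 'c poly. degree q > 0 \<and> (\<forall>i. coeff q i \<in> Qp_bar) \<longrightarrow> (\<exists>x\<in>Qp_bar. poly q x = 0)) \<and>
     closure (Qp_bar :: 'c set) = UNIV"

definition fractional_powers :: "nat \<Rightarrow> (rat \<Rightarrow> 'c::complete_nonarch_field) \<Rightarrow> bool" where
  "fractional_powers p ppow \<longleftrightarrow>
     (\<forall>r r'. ppow (r + r') = ppow r * ppow r') \<and> ppow 1 = of_nat p"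

text \<open>The value group of the \<open>p\<close>-adic complex numbers is \<open>{p\<^sup>r | r \<in> \<rat>}\<close>, so for \<open>a \<noteq> 0\<close> the valuation
  is a well-defined rational number. No meaning is attached to the value at \<open>a = 0\<close>.\<close>

definition vp :: "nat \<Rightarrow> 'c::complete_nonarch_field \<Rightarrow> rat" where
  "vp p a = (THE r. vabs a = real p powr (- of_rat r))"

definition hat :: "nat \<Rightarrow> (rat \<Rightarrow> 'c) \<Rightarrow> 'c::complete_nonarch_field \<Rightarrow> 'c" where
  "hat p ppow a = lim (\<lambda>n. (a / ppow (vp p a)) ^ (p ^ fact n))"

definition omega_v :: "nat \<Rightarrow> (rat \<Rightarrow> 'c) \<Rightarrow> 'c::complete_nonarch_field \<Rightarrow> 'c" where
  "omega_v p ppow a = ppow (vp p a) * hat p ppow a"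

definition angle :: "nat \<Rightarrow> (rat \<Rightarrow> 'c) \<Rightarrow> 'c::complete_nonarch_field \<Rightarrow> 'c" where
  "angle p ppow a = a / omega_v p ppow a"

definition angle_pow :: "nat \<Rightarrow> (rat \<Rightarrow> 'c) \<Rightarrow> 'c::complete_nonarch_field \<Rightarrow> 'c \<Rightarrow> 'c" where
  "angle_pow p ppow a s = (\<Sum>n. (s gchoose n) * (angle p ppow a - 1) ^ n)"

text \<open>The clause \<open>L 0 = 0\<close> is only there because functions are total: it makes \<open>L\<close> unique.\<close>

definition iwasawa_log :: "nat \<Rightarrow> 'c::complete_nonarch_field \<Rightarrow> 'c" where
  "iwasawa_log p = (THE L.
     (\<forall>x y. x \<noteq> 0 \<and> y \<noteq> 0 \<longrightarrow> L (x * y) = L x + L y) \<and>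
     (\<forall>x. vabs (x - 1) < 1 \<longrightarrow> (\<lambda>n. (-1) ^ n * (x - 1) ^ Suc n / of_nat (Suc n)) sums L x) \<and>
     L (of_nat p) = 0 \<and> L 0 = 0)"


definition DD :: "'c::complete_nonarch_field set \<Rightarrow> real \<Rightarrow> 'c set" where
  "DD \<sigma> r = (\<Union>a\<in>\<sigma>. ball a r)"

text \<open>Functions on \<open>DD \<sigma> r\<close> are represented by total functions whose values outside \<open>DD \<sigma> r\<close> are
  irrelevant; passing to germs below removes the ambiguity.\<close>

definition BB :: "'c::complete_nonarch_field set \<Rightarrow> real \<Rightarrow> ('c \<Rightarrow> 'c) set" where
  "BB \<sigma> r = {f. (\<forall>a\<in>\<sigma>. \<exists>c. \<forall>z\<in>ball a r. (\<lambda>n. c n * (z - a) ^ n) sums f z) \<and>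
                (\<exists>C. \<forall>z\<in>DD \<sigma> r. vabs (f z) \<le> C)}"

text \<open>The inserted \<open>0\<close> only matters for \<open>\<sigma> = {}\<close>, where it makes the supremum \<open>0\<close>.\<close>

definition BB_norm :: "'c::complete_nonarch_field set \<Rightarrow> real \<Rightarrow> ('c \<Rightarrow> 'c) \<Rightarrow> real" where
  "BB_norm \<sigma> r f = Sup (insert 0 ((\<lambda>z. vabs (f z)) ` DD \<sigma> r))"

definition germ :: "'c::complete_nonarch_field set \<Rightarrow> ('c \<Rightarrow> 'c) \<Rightarrow> ('c \<Rightarrow> 'c) set" where
  "germ \<sigma> f = {g. \<exists>r>0. \<forall>z\<in>DD \<sigma> r. g z = f z}"

definition LL :: "'c::complete_nonarch_field set \<Rightarrow> ('c \<Rightarrow> 'c) set set" where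
  "LL \<sigma> = (\<Union>r\<in>{0<..}. germ \<sigma> ` BB \<sigma> r)"

text \<open>The inductive limit topology on \<open>LL \<sigma>\<close> is the finest locally convex topology for which all maps
  \<open>germ \<sigma> : BB \<sigma> r \<rightarrow> LL \<sigma>\<close> are continuous. Over a nonarchimedean field, locally convex means that
  the submodules over the closed unit ball (the ring of integers) that are neighbourhoods of \<open>0\<close>
  form a neighbourhood base of \<open>0\<close>; here these are exactly the submodules whose preimage
  in each \<open>BB \<sigma> r\<close> contains a ball around \<open>0\<close>.\<close>

definition LL_lattice :: "'c::complete_nonarch_field set \<Rightarrow> ('c \<Rightarrow> 'c) set set \<Rightarrow> bool" where
  "LL_lattice \<sigma> V \<longleftrightarrow> V \<subseteq> LL \<sigma> \<and>
     (\<forall>f g. germ \<sigma> f \<in> V \<and> germ \<sigma> g \<in> V \<longrightarrow> germ \<sigma> (\<lambda>z. f z + g z) \<in> V) \<and>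
     (\<forall>c f. vabs c \<le> 1 \<and> germ \<sigma> f \<in> V \<longrightarrow> germ \<sigma> (\<lambda>z. c * f z) \<in> V) \<and>
     (\<forall>r>0. \<exists>e>0. \<forall>f\<in>BB \<sigma> r. BB_norm \<sigma> r f < e \<longrightarrow> germ \<sigma> f \<in> V)"

definition LL_open :: "'c::complete_nonarch_field set \<Rightarrow> ('c \<Rightarrow> 'c) set set \<Rightarrow> bool" where
  "LL_open \<sigma> U \<longleftrightarrow> U \<subseteq> LL \<sigma> \<and>
     (\<forall>f. germ \<sigma> f \<in> U \<longrightarrow>
        (\<exists>V. LL_lattice \<sigma> V \<and> (\<forall>g. germ \<sigma> g \<in> V \<longrightarrow> germ \<sigma> (\<lambda>z. f z + g z) \<in> U)))"

lemma LL_lattice_Int: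
  assumes "LL_lattice \<sigma> V" "LL_lattice \<sigma> W"
  shows "LL_lattice \<sigma> (V \<inter> W)"
proof -
  have "\<exists>e>0. \<forall>f\<in>BB \<sigma> r. BB_norm \<sigma> r f < e \<longrightarrow> germ \<sigma> f \<in> V \<inter> W" if "r > 0" for r
  proof -
    obtain d where "d > 0" "\<forall>f\<in>BB \<sigma> r. BB_norm \<sigma> r f < d \<longrightarrow> germ \<sigma> f \<in> V"
      using assms(1) \<open>r > 0\<close> unfolding LL_lattice_def by metis
    moreover obtain e where "e > 0" "\<forall>f\<in>BB \<sigma> r. BB_norm \<sigma> r f < e \<longrightarrow> germ \<sigma> f \<in> W"
      using assms(2) \<open>r > 0\<close> unfolding LL_lattice_def by metis
    ultimately show ?thesis
      by (intro exI[of _ "min d e"]) auto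
  qed
  with assms show ?thesis
    unfolding LL_lattice_def by auto
qed

lemma istopology_LL_open: "istopology (LL_open \<sigma>)"
proof -
  have Int: "LL_open \<sigma> (S \<inter> T)" if S: "LL_open \<sigma> S" and T: "LL_open \<sigma> T" for S T
  proof -
    have "\<exists>V. LL_lattice \<sigma> V \<and> (\<forall>g. germ \<sigma> g \<in> V \<longrightarrow> germ \<sigma> (\<lambda>z. f z + g z) \<in> S \<inter> T)"
      if f: "germ \<sigma> f \<in> S \<inter> T" for f
    proof -
      obtain V where "LL_lattice \<sigma> V" "\<forall>g. germ \<sigma> g \<in> V \<longrightarrow> germ \<sigma> (\<lambda>z. f z + g z) \<in> S"
        using S f unfolding LL_open_def by blast
      moreover obtain W where "LL_lattice \<sigma> W" "\<forall>g. germ \<sigma> g \<in> W \<longrightarrow> germ \<sigma> (\<lambda>z. f z + g z) \<in> T"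
        using T f unfolding LL_open_def by blast
      ultimately show ?thesis
        using LL_lattice_Int by (intro exI[of _ "V \<inter> W"]) auto
    qed
    moreover have "S \<inter> T \<subseteq> LL \<sigma>"
      using S unfolding LL_open_def by blast
    ultimately show ?thesis
      unfolding LL_open_def by blast
  qed
  have Un: "LL_open \<sigma> (\<Union>K)" if K: "\<forall>S\<in>K. LL_open \<sigma> S" for K
    unfolding LL_open_def
  proof (intro conjI allI impI)
    show "\<Union>K \<subseteq> LL \<sigma>"
      using K unfolding LL_open_def by blast
  next
    fix f assume "germ \<sigma> f \<in> \<Union>K"
    then obtain S where S: "S \<in> K" "germ \<sigma> f \<in> S"
      by blast
    then obtain V where "LL_lattice \<sigma> V" "\<forall>g. germ \<sigma> g \<in> V \<longrightarrow> germ \<sigma> (\<lambda>z. f z + g z) \<in> S"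
      using K unfolding LL_open_def by blast
    with S show "\<exists>V. LL_lattice \<sigma> V \<and> (\<forall>g. germ \<sigma> g \<in> V \<longrightarrow> germ \<sigma> (\<lambda>z. f z + g z) \<in> \<Union>K)"
      by blast
  qed
  from Int Un show ?thesis
    unfolding istopology_def by blast
qed

definition LL_topology :: "'c::complete_nonarch_field set \<Rightarrow> ('c \<Rightarrow> 'c) set topology" where
  "LL_topology \<sigma> = topology (LL_open \<sigma>)"

lemma openin_LL_topology: "openin (LL_topology \<sigma>) U \<longleftrightarrow> LL_open \<sigma> U"
  by (simp add: LL_topology_def istopology_LL_open)

definition LL_dual :: "'c::complete_nonarch_field set \<Rightarrow> (('c \<Rightarrow> 'c) set \<Rightarrow> 'c) set" where
  "LL_dual \<sigma> = {\<mu>.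
     (\<forall>f g. germ \<sigma> f \<in> LL \<sigma> \<and> germ \<sigma> g \<in> LL \<sigma> \<longrightarrow>
        \<mu> (germ \<sigma> (\<lambda>z. f z + g z)) = \<mu> (germ \<sigma> f) + \<mu> (germ \<sigma> g)) \<and>
     (\<forall>c f. germ \<sigma> f \<in> LL \<sigma> \<longrightarrow> \<mu> (germ \<sigma> (\<lambda>z. c * f z)) = c * \<mu> (germ \<sigma> f)) \<and>
     continuous_map (LL_topology \<sigma>) euclidean \<mu>}"

definition dist_integral ::
    "'c::complete_nonarch_field set \<Rightarrow> (('c \<Rightarrow> 'c) set \<Rightarrow> 'c) \<Rightarrow> ('c \<Rightarrow> 'c) \<Rightarrow> 'c" where
  "dist_integral \<sigma> \<mu> f = \<mu> (germ \<sigma> f)"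


text \<open>The library's derivative is restricted to real normed fields.\<close>

definition has_padic_deriv ::
    "('c \<Rightarrow> 'c) \<Rightarrow> 'c \<Rightarrow> 'c::complete_nonarch_field set \<Rightarrow> 'c \<Rightarrow> bool" where
  "has_padic_deriv f D S a \<longleftrightarrow> ((\<lambda>s. (f s - f a) / (s - a)) \<longlongrightarrow> D) (at a within S)"

definition padic_deriv :: "('c \<Rightarrow> 'c) \<Rightarrow> 'c::complete_nonarch_field set \<Rightarrow> 'c \<Rightarrow> 'c" where
  "padic_deriv f S a = (THE D. has_padic_deriv f D S a)"

definition zeta :: "nat \<Rightarrow> (rat \<Rightarrow> 'c) \<Rightarrow> 'c::complete_nonarch_field set \<Rightarrow>
    (('c \<Rightarrow> 'c) set \<Rightarrow> 'c) \<Rightarrow> 'c \<Rightarrow> 'c \<Rightarrow> 'c" where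
  "zeta p ppow \<sigma> \<mu> s lam =
     1 / (s - 1) * dist_integral \<sigma> \<mu> (\<lambda>x. angle_pow p ppow (lam + x) (1 - s))"

definition zeta_E :: "nat \<Rightarrow> (rat \<Rightarrow> 'c) \<Rightarrow> 'c::complete_nonarch_field set \<Rightarrow>
    (('c \<Rightarrow> 'c) set \<Rightarrow> 'c) \<Rightarrow> 'c \<Rightarrow> 'c \<Rightarrow> 'c" where
  "zeta_E p ppow \<sigma> \<nu> s lam =
     dist_integral \<sigma> \<nu> (\<lambda>x. angle_pow p ppow (lam + x) (1 - s))"

definition log_Gamma :: "nat \<Rightarrow> (rat \<Rightarrow> 'c) \<Rightarrow> 'c::complete_nonarch_field set \<Rightarrow>
    (('c \<Rightarrow> 'c) set \<Rightarrow> 'c) \<Rightarrow> 'c \<Rightarrow> 'c" where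
  "log_Gamma p ppow \<sigma> \<mu> lam =
     omega_v p ppow lam * padic_deriv (\<lambda>s. zeta p ppow \<sigma> \<mu> s lam) (Zp - {1}) 0"

definition log_Gamma_E :: "nat \<Rightarrow> (rat \<Rightarrow> 'c) \<Rightarrow> 'c::complete_nonarch_field set \<Rightarrow>
    (('c \<Rightarrow> 'c) set \<Rightarrow> 'c) \<Rightarrow> 'c \<Rightarrow> 'c" where
  "log_Gamma_E p ppow \<sigma> \<nu> lam =
     omega_v p ppow lam * padic_deriv (\<lambda>s. zeta_E p ppow \<sigma> \<nu> s lam) Zp 0"

end

theory Submission imports Defs
begin

text \<open>For \<open>|lam|\<close> larger than all \<open>|x|\<close>, \<open>omega_v (lam + x) = omega_v lam\<close>, so that \<open>\<langle>lam + x\<rangle> = 1 + t x\<close>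
  with \<open>t\<close> affine in \<open>x\<close> and \<open>|t x| \<le> \<rho> < 1\<close>. The difference quotients of \<open>(1 + t)\<^sup>1\<^sup>-\<^sup>s\<close>
  at \<open>s = 0\<close> converge to \<open>- (1 + t) log (1 + t)\<close> uniformly for \<open>|t| \<le> \<rho>\<close>, hence in the norm of
  \<open>BB \<sigma> 1\<close>, and a continuous functional may be applied to the limit. The Iwasawa logarithm of
  \<open>lam + x\<close> is the logarithm series at \<open>t x\<close>: the residue field is algebraic over the
  field with \<open>p\<close> elements, so \<open>omega_v\<close> is well defined and multiplicative and every nonzero element is,
  up to torsion and fractional powers of \<open>p\<close>, congruent to \<open>1\<close>.\<close>

subsection \<open>Nonarchimedean fields\<close>

text \<open>\<open>vp\<close> and \<open>iwasawa_log\<close> are definite descriptions and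
  \<open>hat\<close> is a limit, so nothing can be computed with them before existence and
  uniqueness are established; this is why the value group and the residue field have to be analysed.
  On the analytic side the two basic estimates are \<open>vabs (s gchoose n) \<le> 1\<close> for
  \<open>s\<close> in \<open>Zp\<close> and \<open>1 / n \<le> vabs (of_nat n)\<close>.
  Multiplicativity of \<open>(1 + t)^s\<close> in \<open>1 + t\<close> is inherited from natural
  exponents by density, and the functional equation of the logarithm is read off from the derivative
  at \<open>s = 0\<close>, so no power series are composed or rearranged. The same multiplicativity
  re-expands both functions about every centre in \<open>\<sigma>\<close>, which membership in
  \<open>BB\<close> demands. The summand \<open>-1\<close> in the first formula comes from
  differentiating the factor \<open>1 / (s - 1)\<close>.\<close>

lemma vabs_zero [simp]: "vabs (0 :: 'a::complete_nonarch_field) = 0"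
  using dist_vabs[of "0 :: 'a" 0] by simp

lemma vabs_nonneg [simp]: "0 \<le> vabs x"
  using dist_vabs[of x 0] zero_le_dist[of x 0] by simp

lemma vabs_eq_0_iff [simp]: "vabs x = 0 \<longleftrightarrow> x = 0"
  using dist_vabs[of x 0] dist_eq_0_iff[of x 0] by simp

lemma vabs_pos_iff [simp]: "0 < vabs x \<longleftrightarrow> x \<noteq> 0"
  using vabs_nonneg[of x] vabs_eq_0_iff[of x] by linarith

lemma vabs_one [simp]: "vabs (1 :: 'a::complete_nonarch_field) = 1"
  using vabs_mult[of 1 "1 :: 'a"] vabs_eq_0_iff[of "1 :: 'a"] by simp

lemma vabs_power: "vabs (x ^ n) = vabs x ^ n"
  by (induction n) (simp_all add: vabs_mult)

lemma vabs_minus [simp]: "vabs (- x) = vabs x"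
  for x :: "'a::complete_nonarch_field"
proof -
  have "vabs (-1 :: 'a) ^ 2 = 1"
    using vabs_mult[of "-1" "-1 :: 'a"] by (simp add: power2_eq_square)
  hence "vabs (-1 :: 'a) = 1"
    using vabs_nonneg[of "-1 :: 'a"] by (simp add: power2_eq_1_iff)
  thus ?thesis
    using vabs_mult[of "-1" x] by simp
qed

lemma vabs_minus_commute: "vabs (x - y) = vabs (y - x)"
  using vabs_minus[of "x - y"] by simp

lemma vabs_inverse: "vabs (inverse x) = inverse (vabs x)"
proof (cases "x = 0")
  case False
  hence "vabs x * vabs (inverse x) = 1"
    using vabs_mult[of x "inverse x"] by simp
  thus ?thesis
    using False by (simp add: field_simps)
qed auto

lemma vabs_divide: "vabs (x / y) = vabs x / vabs y"
  by (simp add: divide_inverse vabs_mult vabs_inverse)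

lemma vabs_diff: "vabs (x - y) \<le> max (vabs x) (vabs y)"
  using vabs_add[of x "- y"] by simp

lemma vabs_diff_trans: "vabs (x - z) \<le> max (vabs (x - y)) (vabs (y - z))"
  using vabs_add[of "x - y" "y - z"] by simp

lemma vabs_add_le: "vabs x \<le> c \<Longrightarrow> vabs y \<le> c \<Longrightarrow> vabs (x + y) \<le> c"
  using vabs_add[of x y] by linarith

lemma vabs_add_less: "vabs x < c \<Longrightarrow> vabs y < c \<Longrightarrow> vabs (x + y) < c"
  using vabs_add[of x y] by linarith

lemma vabs_diff_le: "vabs x \<le> c \<Longrightarrow> vabs y \<le> c \<Longrightarrow> vabs (x - y) \<le> c"
  using vabs_diff[of x y] by linarith

lemma vabs_diff_less: "vabs x < c \<Longrightarrow> vabs y < c \<Longrightarrow> vabs (x - y) < c"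
  using vabs_diff[of x y] by linarith

lemma vabs_eq_of_close: "vabs (x - y) < vabs y \<Longrightarrow> vabs x = vabs y"
  using vabs_add[of "x - y" y] vabs_diff[of x "x - y"] by (auto simp: max_def split: if_splits)

lemma vabs_one_plus: "vabs t < 1 \<Longrightarrow> vabs (1 + t) = 1"
  using vabs_eq_of_close[of "1 + t" 1] by simp

lemma vabs_mult_le_one: "vabs x \<le> 1 \<Longrightarrow> vabs y \<le> 1 \<Longrightarrow> vabs (x * y) \<le> 1"
  by (simp add: vabs_mult mult_le_one)

lemma vabs_mult_less_one: "vabs x \<le> 1 \<Longrightarrow> vabs y < 1 \<Longrightarrow> vabs (x * y) < 1"
  using mult_left_le_one_le[of "vabs y" "vabs x"] by (simp add: vabs_mult)

lemma vabs_sum_le: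
  assumes "\<And>i. i \<in> I \<Longrightarrow> vabs (f i) \<le> c" "0 \<le> c"
  shows "vabs (sum f I) \<le> c"
  using assms by (induction I rule: infinite_finite_induct) (auto intro!: vabs_add_le)

lemma vabs_sum_less:
  assumes "\<And>i. i \<in> I \<Longrightarrow> vabs (f i) < c" "0 < c"
  shows "vabs (sum f I) < c"
  using assms by (induction I rule: infinite_finite_induct) (auto intro!: vabs_add_less)

lemma vabs_of_nat_le_one: "vabs (of_nat n) \<le> 1"
  by (induction n) (auto intro!: vabs_add_le)

lemma vabs_of_int_le_one: "vabs (of_int k) \<le> 1"
  by (cases k rule: int_cases2) (simp_all add: vabs_of_nat_le_one)

lemma ball_vabs: "z \<in> ball a r \<longleftrightarrow> vabs (z - a) < r"
  for z :: "'c::complete_nonarch_field"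
  by (simp add: mem_ball dist_vabs vabs_minus_commute)

lemma tendsto_vabs_iff: "(f \<longlongrightarrow> l) F \<longleftrightarrow> ((\<lambda>x. vabs (f x - l)) \<longlongrightarrow> 0) F"
  for l :: "'c::complete_nonarch_field"
  by (subst tendsto_dist_iff) (simp add: dist_vabs)

lemma tendstoI_vabs_bound:
  fixes l :: "'c::complete_nonarch_field"
  assumes "eventually (\<lambda>x. vabs (f x - l) \<le> g x) F" "(g \<longlongrightarrow> 0) F"
  shows "(f \<longlongrightarrow> l) F"
  unfolding tendsto_vabs_iff
  by (rule tendsto_sandwich[OF _ assms(1) tendsto_const assms(2)]) auto

text \<open>Continuity of the field operations is derived from \<open>vabs\<close> once; this
  instance and the next make the general limit rules applicable.\<close>

instance complete_nonarch_field \<subseteq> topological_ab_group_add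
proof
  fix a b :: 'a
  have 1: "((\<lambda>x. vabs (fst x - a)) \<longlongrightarrow> 0) (nhds a \<times>\<^sub>F nhds b)"
    using filterlim_fst[of "nhds a" "nhds b"] by (simp add: tendsto_vabs_iff)
  have 2: "((\<lambda>x. vabs (snd x - b)) \<longlongrightarrow> 0) (nhds a \<times>\<^sub>F nhds b)"
    using filterlim_snd[of "nhds b" "nhds a"] by (simp add: tendsto_vabs_iff)
  show "LIM x (nhds a \<times>\<^sub>F nhds b). fst x + snd x :> nhds (a + b)"
  proof (rule tendstoI_vabs_bound)
    show "((\<lambda>x. max (vabs (fst x - a)) (vabs (snd x - b))) \<longlongrightarrow> 0) (nhds a \<times>\<^sub>F nhds b)"
      using tendsto_max[OF 1 2] by simp
    have "vabs (x + y - (a + b)) \<le> max (vabs (x - a)) (vabs (y - b))" for x y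
      using vabs_add[of "x - a" "y - b"] by (simp add: algebra_simps)
    thus "\<forall>\<^sub>F x in nhds a \<times>\<^sub>F nhds b.
        vabs (fst x + snd x - (a + b)) \<le> max (vabs (fst x - a)) (vabs (snd x - b))"
      by simp
  qed
  have 3: "((\<lambda>x. vabs (x - a)) \<longlongrightarrow> 0) (nhds a)"
    using filterlim_ident[of "nhds a"] by (simp add: tendsto_vabs_iff)
  show "(uminus \<longlongrightarrow> - a) (nhds a)"
    by (rule tendstoI_vabs_bound[OF _ 3]) (simp add: vabs_minus_commute)
qed

instance complete_nonarch_field \<subseteq> topological_comm_monoid_mult
proof
  fix a b :: 'a
  have 1: "((\<lambda>x. vabs (fst x - a)) \<longlongrightarrow> 0) (nhds a \<times>\<^sub>F nhds b)"
    using filterlim_fst[of "nhds a" "nhds b"] by (simp add: tendsto_vabs_iff)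
  have 2: "((\<lambda>x. vabs (snd x - b)) \<longlongrightarrow> 0) (nhds a \<times>\<^sub>F nhds b)"
    using filterlim_snd[of "nhds b" "nhds a"] by (simp add: tendsto_vabs_iff)
  show "LIM x (nhds a \<times>\<^sub>F nhds b). fst x * snd x :> nhds (a * b)"
  proof (rule tendstoI_vabs_bound)
    let ?g = "\<lambda>x. vabs (fst x - a) * vabs (snd x - b) + vabs (fst x - a) * vabs b
                    + vabs a * vabs (snd x - b)"
    have "(?g \<longlongrightarrow> 0 * 0 + 0 * vabs b + vabs a * 0) (nhds a \<times>\<^sub>F nhds b)"
      by (intro tendsto_intros 1 2)
    thus "(?g \<longlongrightarrow> 0) (nhds a \<times>\<^sub>F nhds b)"
      by simp
    have add: "vabs (x + y) \<le> vabs x + vabs y" for x y :: 'a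
      using vabs_add[of x y] vabs_nonneg[of x] vabs_nonneg[of y] by linarith
    have "vabs (x * y - a * b) \<le> vabs (x - a) * vabs (y - b) + vabs (x - a) * vabs b
              + vabs a * vabs (y - b)" for x y
    proof -
      have "x * y - a * b = (x - a) * (y - b) + (x - a) * b + a * (y - b)"
        by (simp add: algebra_simps)
      thus ?thesis
        using add[of "(x - a) * (y - b) + (x - a) * b" "a * (y - b)"]
          add[of "(x - a) * (y - b)" "(x - a) * b"] by (simp add: vabs_mult)
    qed
    thus "\<forall>\<^sub>F x in nhds a \<times>\<^sub>F nhds b. vabs (fst x * snd x - a * b) \<le> ?g x"
      by simp
  qed
qed

lemma tendsto_vabs:
  fixes l :: "'c::complete_nonarch_field"
  assumes "(f \<longlongrightarrow> l) F"
  shows "((\<lambda>x. vabs (f x)) \<longlongrightarrow> vabs l) F"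
  using tendsto_dist[OF assms tendsto_const[of 0]] by (simp add: dist_vabs)

lemma vabs_lim_le:
  fixes l :: "'c::complete_nonarch_field"
  assumes "(f \<longlongrightarrow> l) F" "eventually (\<lambda>x. vabs (f x) \<le> c) F" "F \<noteq> bot"
  shows "vabs l \<le> c"
  using tendsto_upperbound[OF tendsto_vabs[OF assms(1)] assms(2,3)] .

text \<open>A difference \<open>X n - X N\<close> telescopes, and in an ultrametric a sum is at most
  as large as its largest summand, so small consecutive steps already give the Cauchy
  property.\<close>

lemma Cauchy_if_consecutive_vabs:
  fixes X :: "nat \<Rightarrow> 'c::complete_nonarch_field"
  assumes "(\<lambda>n. vabs (X (Suc n) - X n)) \<longlonglongrightarrow> 0"
  shows "convergent X"
proof (rule Cauchy_convergent, rule metric_CauchyI)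
  fix e :: real assume e: "e > 0"
  then obtain N where N: "\<And>n. n \<ge> N \<Longrightarrow> vabs (X (Suc n) - X n) < e"
    using order_tendstoD(2)[OF assms e] by (auto simp: eventually_sequentially)
  have *: "vabs (X n - X N) < e" if "n \<ge> N" for n
    using that
  proof (induction n rule: dec_induct)
    case (step n)
    thus ?case
      using vabs_diff_trans[of "X (Suc n)" "X N" "X n"] N[of n] by linarith
  qed (use e in auto)
  show "\<exists>M. \<forall>m\<ge>M. \<forall>n\<ge>M. dist (X m) (X n) < e"
  proof (intro exI allI impI)
    fix m n assume "m \<ge> N" "n \<ge> N"
    thus "dist (X m) (X n) < e"
      using *[of m] *[of n] vabs_diff_trans[of "X m" "X n" "X N"] vabs_minus_commute[of "X N" "X n"]
      by (simp add: dist_vabs)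
  qed
qed

lemma summable_vabs_iff: "summable f \<longleftrightarrow> (\<lambda>n. vabs (f n)) \<longlonglongrightarrow> 0"
  for f :: "nat \<Rightarrow> 'c::complete_nonarch_field"
proof
  assume f: "(\<lambda>n. vabs (f n)) \<longlonglongrightarrow> 0"
  show "summable f"
    unfolding summable_iff_convergent
    by (rule Cauchy_if_consecutive_vabs) (use f in simp)
next
  assume "summable f"
  then obtain l where l: "(\<lambda>n. \<Sum>i<n. f i) \<longlonglongrightarrow> l"
    by (auto simp: summable_def sums_def)
  have "(\<lambda>n. (\<Sum>i<Suc n. f i) - (\<Sum>i<n. f i)) \<longlonglongrightarrow> l - l"
    by (intro tendsto_diff l LIMSEQ_Suc[OF l])
  thus "(\<lambda>n. vabs (f n)) \<longlonglongrightarrow> 0"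
    using tendsto_vabs by fastforce
qed

lemma summable_vabs_bound:
  fixes f :: "nat \<Rightarrow> 'c::complete_nonarch_field"
  assumes "\<And>n. vabs (f n) \<le> g n" "g \<longlonglongrightarrow> 0"
  shows "summable f"
  unfolding summable_vabs_iff
  by (rule tendsto_sandwich[OF _ _ tendsto_const assms(2)]) (use assms(1) in auto)

lemma vabs_sums_le:
  fixes f :: "nat \<Rightarrow> 'c::complete_nonarch_field"
  assumes "f sums s" "\<And>n. vabs (f n) \<le> c"
  shows "vabs s \<le> c"
proof -
  have "0 \<le> c"
    using assms(2)[of 0] vabs_nonneg[of "f 0"] by linarith
  show ?thesis
    by (rule vabs_lim_le[OF assms(1)[unfolded sums_def]])
       (auto intro!: always_eventually vabs_sum_le assms(2) \<open>0 \<le> c\<close>)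
qed

lemma sums_mult_nonarch:
  fixes c :: "'c::complete_nonarch_field"
  assumes "f sums s"
  shows "(\<lambda>n. c * f n) sums (c * s)"
  using tendsto_mult[OF tendsto_const[of c] assms[unfolded sums_def]]
  by (simp add: sums_def sum_distrib_left)

lemma sums_diff_nonarch:
  fixes f g :: "nat \<Rightarrow> 'c::complete_nonarch_field"
  assumes "f sums a" "g sums b"
  shows "(\<lambda>n. f n - g n) sums (a - b)"
  using tendsto_diff[OF assms[unfolded sums_def]] by (simp add: sums_def sum_subtractf)

subsection \<open>Integers and rationals with a \<open>p\<close>-adic absolute value\<close>

locale padic_field =
  fixes p :: nat and T :: "'c::complete_nonarch_field itself"
  assumes prime_p: "prime p" and vabs_p: "vabs (of_nat p :: 'c) = 1 / real p"
begin

lemma p_gt_1: "1 < p"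
  using prime_p prime_gt_1_nat by blast

lemma vabs_p_less_one: "1 / real p < 1"
  using p_gt_1 by simp

lemma vabs_p_power: "vabs (of_nat (p ^ k) :: 'c) = (1 / real p) ^ k"
  by (simp add: vabs_power vabs_p)

lemma vabs_p_power_tendsto: "(\<lambda>k. vabs (of_nat (p ^ k) :: 'c)) \<longlonglongrightarrow> 0"
  unfolding vabs_p_power using p_gt_1 by (intro LIMSEQ_power_zero) simp

lemma vabs_of_int_dvd:
  assumes "int p dvd k"
  shows "vabs (of_int k :: 'c) \<le> 1 / real p"
proof -
  obtain j where "k = int p * j"
    using assms by blast
  thus ?thesis
    using mult_right_le_one_le[of "1 / real p" "vabs (of_int j :: 'c)"]
    by (simp add: vabs_mult vabs_p vabs_of_int_le_one)
qed

text \<open>If \<open>k\<close> were small as well as \<open>p\<close>, the Bezout combination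
  \<open>1 = a p + b k\<close> would have absolute value below 1.\<close>

lemma vabs_of_int_coprime:
  assumes "\<not> int p dvd k"
  shows "vabs (of_int k :: 'c) = 1"
proof (rule ccontr)
  assume "vabs (of_int k :: 'c) \<noteq> 1"
  hence k: "vabs (of_int k :: 'c) < 1"
    using vabs_of_int_le_one[of k, where ?'a = 'c] by linarith
  have "coprime (int p) k"
    using assms prime_p by (simp add: prime_imp_coprime)
  then obtain a b where "a * int p + b * k = 1"
    using bezout_int[of "int p" k] by auto
  hence "(of_int a * of_nat p + of_int b * of_int k :: 'c) = 1"
    by (metis of_int_1 of_int_add of_int_mult of_int_of_nat_eq)
  moreover have "vabs (of_int a * of_nat p + of_int b * of_int k :: 'c) < 1"
    using k vabs_p vabs_p_less_one
    by (intro vabs_add_less vabs_mult_less_one vabs_of_int_le_one) auto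
  ultimately show False
    by simp
qed

lemma vabs_of_nat_pos:
  assumes "n > 0"
  shows "\<exists>k. p ^ k dvd n \<and> vabs (of_nat n :: 'c) = 1 / real p ^ k"
proof -
  obtain m where m: "n = p ^ multiplicity p n * m" "\<not> p dvd m"
    using multiplicity_decompose'[of n p] assms prime_p
    by (metis bot_nat_0.not_eq_extremum not_prime_unit)
  have "vabs (of_nat m :: 'c) = 1"
    using vabs_of_int_coprime[of "int m"] m(2) by simp
  hence "vabs (of_nat n :: 'c) = 1 / real p ^ multiplicity p n"
    by (subst m(1)) (simp add: vabs_mult vabs_power vabs_p power_one_over)
  thus ?thesis
    using m(1) by (metis dvd_triv_left)
qed

text \<open>The power of \<open>p\<close> dividing \<open>n\<close> is at most \<open>n\<close>.
  This controls the denominators of the logarithm series.\<close>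

lemma vabs_of_nat_ge:
  assumes "n > 0"
  shows "1 / real n \<le> vabs (of_nat n :: 'c)"
proof -
  obtain k where k: "p ^ k dvd n" "vabs (of_nat n :: 'c) = 1 / real p ^ k"
    using vabs_of_nat_pos[OF assms] by blast
  have "real p ^ k \<le> real n"
    using dvd_imp_le[OF k(1) assms] by (metis of_nat_le_iff of_nat_power)
  thus ?thesis
    using k(2) p_gt_1 by (simp add: frac_le)
qed

lemma vabs_of_int_nonzero:
  assumes "k \<noteq> 0"
  shows "\<exists>j. vabs (of_int k :: 'c) = real p powr of_int j"
proof -
  obtain i where "vabs (of_nat (nat \<bar>k\<bar>) :: 'c) = 1 / real p ^ i"
    using vabs_of_nat_pos[of "nat \<bar>k\<bar>"] assms by auto
  moreover have "vabs (of_nat (nat \<bar>k\<bar>) :: 'c) = vabs (of_int k :: 'c)"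
    by (cases "k \<ge> 0") (simp_all add: abs_if)
  ultimately have "vabs (of_int k :: 'c) = real p powr of_int (- int i)"
    using p_gt_1 by (simp add: powr_minus powr_realpow divide_inverse)
  thus ?thesis
    by blast
qed

lemma vabs_Rats_nonzero:
  assumes "a \<in> \<rat>" "a \<noteq> (0 :: 'c)"
  shows "\<exists>j. vabs a = real p powr of_int j"
proof -
  obtain x y where xy: "y > 0" "a = of_int x / of_int y"
    using assms(1) by (elim Rats_cases') blast
  hence "x \<noteq> 0"
    using assms(2) by auto
  then obtain i j where "vabs (of_int x :: 'c) = real p powr of_int i"
      "vabs (of_int y :: 'c) = real p powr of_int j"
    using vabs_of_int_nonzero xy(1) by (metis less_irrefl)
  hence "vabs a = real p powr of_int (i - j)"
    using xy by (simp add: vabs_divide powr_diff)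
  thus ?thesis
    by blast
qed

text \<open>The rationals have the residue field with \<open>p\<close> elements: in lowest terms the
  denominator \<open>y\<close> is a unit, and if \<open>v\<close> inverts \<open>y\<close> modulo
  \<open>p\<close>, the integer \<open>v * x\<close> has the same residue as
  \<open>x / y\<close>.\<close>

lemma Rats_near_int:
  assumes "a \<in> \<rat>" "vabs (a :: 'c) \<le> 1"
  shows "\<exists>k. vabs (a - of_int k) < 1"
proof -
  obtain x y where xy: "y > 0" "coprime x y" "a = of_int x / of_int y"
    using assms(1) by (elim Rats_cases') blast
  have "vabs (of_int y :: 'c) = 1"
  proof (rule ccontr)
    assume y: "vabs (of_int y :: 'c) \<noteq> 1"
    hence "int p dvd y"
      using vabs_of_int_coprime by blast
    hence "\<not> int p dvd x"
      using xy(2) prime_p by (meson coprime_common_divisor not_prime_unit prime_nat_int_transfer)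
    hence "vabs a = 1 / vabs (of_int y :: 'c)"
      using vabs_of_int_coprime xy(3) by (simp add: vabs_divide)
    moreover have "vabs (of_int y :: 'c) < 1" "vabs (of_int y :: 'c) > 0"
      using y vabs_of_int_le_one[of y, where ?'a = 'c] xy(1) by auto
    ultimately show False
      using assms(2) by (simp add: field_simps)
  qed
  hence "\<not> int p dvd y"
    using vabs_of_int_dvd[of y] vabs_p_less_one by linarith
  hence "coprime (int p) y"
    using prime_p by (simp add: prime_imp_coprime)
  then obtain u v where uv: "u * int p + v * y = 1"
    using bezout_int[of "int p" y] by auto
  have "x - v * x * y = u * x * int p"
    using arg_cong[OF uv, of "\<lambda>z. z * x"] by (simp add: algebra_simps)
  hence "vabs (of_int (x - v * x * y) :: 'c) < 1"
    using vabs_of_int_dvd[of "x - v * x * y"] vabs_p_less_one by simp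
  moreover have "a - of_int (v * x) = of_int (x - v * x * y) / of_int y"
    using xy by (simp add: field_simps)
  ultimately have "vabs (a - of_int (v * x)) < 1"
    using \<open>vabs (of_int y :: 'c) = 1\<close> by (simp add: vabs_divide)
  thus ?thesis
    by blast
qed

lemma in_Zp_iff: "x \<in> Zp \<longleftrightarrow> (\<forall>e>0. \<exists>k::int. vabs (x - of_int k :: 'c) < e)"
  unfolding Zp_def closure_approachable
  by (auto simp: dist_vabs vabs_minus_commute[of x] elim!: Ints_cases) (metis Ints_of_int vabs_minus_commute)+

lemma of_int_in_Zp [simp]: "of_int k \<in> (Zp :: 'c set)"
  unfolding Zp_def by (meson Ints_of_int closure_subset subsetD)

lemma of_nat_in_Zp [simp]: "of_nat n \<in> (Zp :: 'c set)"
  using of_int_in_Zp[of "int n"] by simp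

lemma Zp_diff:
  assumes "x \<in> Zp" "y \<in> (Zp :: 'c set)"
  shows "x - y \<in> Zp"
  unfolding in_Zp_iff
proof (intro allI impI)
  fix e :: real assume "e > 0"
  then obtain k l where "vabs (x - of_int k) < e" "vabs (y - of_int l) < e"
    using assms unfolding in_Zp_iff by metis
  hence "vabs (x - y - of_int (k - l)) < e"
    using vabs_diff_less[of "x - of_int k" e "y - of_int l"] by (simp add: algebra_simps)
  thus "\<exists>k. vabs (x - y - of_int k) < e"
    by blast
qed

text \<open>A negative integer approximation becomes natural when a multiple of a high power of
  \<open>p\<close> is added, which hardly changes it \<open>p\<close>-adically.\<close>

lemma Zp_near_nat:
  assumes "x \<in> (Zp :: 'c set)" "e > 0"
  shows "\<exists>n. vabs (x - of_nat n) < e"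
proof -
  obtain k where k: "vabs (x - of_int k) < e"
    using assms unfolding in_Zp_iff by metis
  obtain i where i: "vabs (of_nat (p ^ i) :: 'c) < e"
    using order_tendstoD(2)[OF vabs_p_power_tendsto assms(2)]
    by (auto simp: eventually_sequentially)
  \<comment> \<open>The multiplier \<open>\<bar>k\<bar>\<close> is large enough for
    \<open>n \<ge> 0\<close>, and being an integer it does not enlarge \<open>p ^ i\<close>.\<close>
  define n where "n = k + \<bar>k\<bar> * int (p ^ i)"
  have "k + \<bar>k\<bar> * int (p ^ i) \<ge> k + \<bar>k\<bar> * 1"
    using p_gt_1 by (intro add_left_mono mult_left_mono) auto
  hence "n \<ge> 0"
    by (simp add: n_def)
  have "vabs (of_int \<bar>k\<bar> * of_nat (p ^ i) :: 'c) < e"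
    using i mult_left_le_one_le[of "vabs (of_nat (p ^ i) :: 'c)" "vabs (of_int \<bar>k\<bar> :: 'c)"]
    by (simp add: vabs_mult vabs_of_int_le_one del: of_int_abs of_nat_power)
  hence "vabs (x - of_int k - of_int \<bar>k\<bar> * of_nat (p ^ i)) < e"
    using k by (rule vabs_diff_less[rotated])
  hence "vabs (x - of_int n) < e"
    by (simp add: n_def algebra_simps)
  thus ?thesis
    using \<open>n \<ge> 0\<close> by (metis nonneg_int_cases of_int_of_nat_eq)
qed

lemma Zp_nat_seq:
  assumes "x \<in> (Zp :: 'c set)"
  shows "\<exists>f. (\<lambda>n. of_nat (f n)) \<longlonglongrightarrow> x"
proof -
  have "\<exists>k. vabs (x - of_nat k) < inverse (real (Suc n))" for n
    using Zp_near_nat[OF assms] by simp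
  then obtain f where f: "vabs (x - of_nat (f n)) < inverse (real (Suc n))" for n
    by metis
  have "(\<lambda>n. of_nat (f n)) \<longlonglongrightarrow> x"
    by (rule tendstoI_vabs_bound[OF _ LIMSEQ_inverse_real_of_nat])
       (use f in \<open>auto simp: vabs_minus_commute[of _ x] intro!: always_eventually less_imp_le\<close>)
  thus ?thesis
    by blast
qed

text \<open>The powers of \<open>p\<close> tend to 0 inside \<open>Zp\<close>. Only because the
  filters are nontrivial are limits along them unique, so that \<open>padic_deriv\<close> denotes
  the derivative.\<close>

lemma zero_limit_point_Zp: "at (0 :: 'c) within (Zp - {1}) \<noteq> bot" "at (0 :: 'c) within Zp \<noteq> bot"
proof -
  show *: "at (0 :: 'c) within (Zp - {1}) \<noteq> bot"
    unfolding trivial_limit_within islimpt_approachable not_not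
  proof (intro allI impI)
    fix e :: real assume "e > 0"
    have "\<forall>\<^sub>F i in sequentially. vabs (of_nat (p ^ i) :: 'c) < min e 1"
      by (rule order_tendstoD(2)[OF vabs_p_power_tendsto]) (use \<open>e > 0\<close> in simp)
    then obtain i where i: "vabs (of_nat (p ^ i) :: 'c) < min e 1"
      by (auto simp: eventually_sequentially)
    hence "of_nat (p ^ i) \<noteq> (1 :: 'c)"
      by auto
    moreover have "of_nat (p ^ i) \<noteq> (0 :: 'c)"
      using p_gt_1 by simp
    ultimately show "\<exists>x\<in>Zp - {1}. x \<noteq> (0 :: 'c) \<and> dist x 0 < e"
      using i by (intro bexI[of _ "of_nat (p ^ i)"]) (auto simp: dist_vabs simp del: of_nat_power)
  qed
  have "at (0 :: 'c) within (Zp - {1}) \<le> at 0 within Zp"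
    by (rule at_le) auto
  thus "at (0 :: 'c) within Zp \<noteq> bot"
    using * by (metis bot.extremum_uniqueI)
qed

end

subsection \<open>The binomial series and the logarithm\<close>

text \<open>Tannery's theorem in ultrametric form: the tail is controlled by \<open>b\<close>, the
  finitely many remaining terms by their limits. A common bound for all terms also bounds the sum of
  a series.\<close>

lemma eventually_uniform_small:
  fixes a :: "'x \<Rightarrow> nat \<Rightarrow> real"
  assumes lim: "\<And>n. ((\<lambda>x. a x n) \<longlongrightarrow> 0) F"
    and bound: "eventually (\<lambda>x. \<forall>n. a x n \<le> b n) F" and b: "b \<longlonglongrightarrow> 0" and e: "e > 0"
  shows "eventually (\<lambda>x. \<forall>n. a x n \<le> e) F"
proof -
  obtain N where N: "\<And>n. n \<ge> N \<Longrightarrow> b n < e"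
    using order_tendstoD(2)[OF b e] by (auto simp: eventually_sequentially)
  have "eventually (\<lambda>x. \<forall>n\<in>{..<N}. a x n < e) F"
    by (rule eventually_ball_finite) (use order_tendstoD(2)[OF lim e] in auto)
  with bound show ?thesis
  proof eventually_elim
    case (elim x)
    show ?case
    proof
      fix n show "a x n \<le> e"
      proof (cases "n < N")
        case False
        thus ?thesis
          using elim(1) N[of n] by (meson le_less_trans less_imp_le not_less)
      qed (use elim(2) in \<open>auto intro: less_imp_le\<close>)
    qed
  qed
qed

lemma tendsto_gchoose:
  fixes f :: "'x \<Rightarrow> 'c::complete_nonarch_field"
  assumes "(f \<longlongrightarrow> l) F"
  shows "((\<lambda>x. f x gchoose n) \<longlongrightarrow> l gchoose n) F"
proof -
  have "((\<lambda>x. (\<Prod>i = 0..<n. f x - of_nat i) * inverse (fact n)) \<longlongrightarrow>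
         (\<Prod>i = 0..<n. l - of_nat i) * inverse (fact n)) F"
    by (intro tendsto_intros tendsto_prod' assms)
  thus ?thesis
    by (simp add: gbinomial_prod_rev divide_inverse)
qed

lemma minus_one_gchoose: "(-1 :: 'a::field_char_0) gchoose n = (-1) ^ n"
  using gbinomial_negated_upper[of "-1 :: 'a" n] binomial_gbinomial[of n n, where ?'a = 'a] by simp

text \<open>\<open>angle_pow p ppow a s\<close> is this series at
  \<open>t = angle p ppow a - 1\<close>; with \<open>t\<close> as a free variable, estimates can be
  made uniform in it.\<close>

definition one_plus_pow :: "'c::complete_nonarch_field \<Rightarrow> 'c \<Rightarrow> 'c" where
  "one_plus_pow s t = (\<Sum>n. (s gchoose n) * t ^ n)"

definition log_one_plus :: "'c::complete_nonarch_field \<Rightarrow> 'c" where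
  "log_one_plus t = (\<Sum>n. (-1) ^ n * t ^ Suc n / of_nat (Suc n))"

lemma one_plus_pow_of_nat: "one_plus_pow (of_nat m) t = (1 + t) ^ m"
proof -
  have "one_plus_pow (of_nat m) t = (\<Sum>n\<le>m. (of_nat m gchoose n) * t ^ n)"
    unfolding one_plus_pow_def
    by (rule suminf_finite) (simp_all flip: binomial_gbinomial)
  also have "\<dots> = (t + 1) ^ m"
    by (subst binomial_ring) (simp add: binomial_gbinomial)
  finally show ?thesis
    by (simp add: add.commute)
qed

context padic_field
begin

text \<open>For natural \<open>s\<close> the coefficient is a natural number; the general case is a
  limit of these, since the coefficient is a polynomial in \<open>s\<close>.\<close>

lemma vabs_gchoose_le_one:
  assumes "s \<in> (Zp :: 'c set)"
  shows "vabs (s gchoose n) \<le> 1"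
proof -
  obtain f where f: "(\<lambda>i. of_nat (f i)) \<longlonglongrightarrow> s"
    using Zp_nat_seq[OF assms] by blast
  show ?thesis
    by (rule vabs_lim_le[OF tendsto_gchoose[OF f]])
       (simp_all add: vabs_of_nat_le_one flip: binomial_gbinomial)
qed

lemma one_plus_pow_sums:
  assumes "s \<in> (Zp :: 'c set)" "vabs t < 1"
  shows "(\<lambda>n. (s gchoose n) * t ^ n) sums one_plus_pow s t"
  unfolding one_plus_pow_def
proof (rule summable_sums, rule summable_vabs_bound)
  show "vabs ((s gchoose n) * t ^ n) \<le> vabs t ^ n" for n
    using vabs_gchoose_le_one[OF assms(1)] by (simp add: vabs_mult vabs_power mult_left_le_one_le)
  show "(\<lambda>n. vabs t ^ n) \<longlonglongrightarrow> 0"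
    using assms(2) by (intro LIMSEQ_power_zero) simp
qed

lemma one_plus_pow_sums_Suc:
  assumes "s \<in> (Zp :: 'c set)" "vabs t < 1"
  shows "(\<lambda>n. (s gchoose Suc n) * t ^ Suc n) sums (one_plus_pow s t - 1)"
proof -
  have "(\<lambda>n. \<Sum>i<Suc n. (s gchoose i) * t ^ i) \<longlonglongrightarrow> one_plus_pow s t"
    using one_plus_pow_sums[OF assms] by (intro LIMSEQ_Suc) (simp add: sums_def)
  hence "(\<lambda>n. (\<Sum>i<Suc n. (s gchoose i) * t ^ i) - 1) \<longlonglongrightarrow> one_plus_pow s t - 1"
    by (intro tendsto_intros)
  thus ?thesis
    by (simp add: sums_def sum.lessThan_Suc_shift del: sum.lessThan_Suc)
qed

text \<open>The factor \<open>c\<close> serves both for the sign in the logarithm series and, as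
  \<open>c = 1\<close>, for the bare quotient in the derivative estimate.\<close>

lemma vabs_log_term_le:
  assumes "vabs (t :: 'c) \<le> \<rho>" "vabs c \<le> 1"
  shows "vabs (c * t ^ Suc n / of_nat (Suc n)) \<le> real (Suc n) * \<rho> ^ Suc n"
proof -
  have "1 \<le> real (Suc n) * vabs (of_nat (Suc n) :: 'c)"
    using vabs_of_nat_ge[of "Suc n"] by (simp add: field_simps)
  moreover have "0 \<le> \<rho>"
    using assms(1) vabs_nonneg[of t] by linarith
  ultimately have "vabs c * vabs t ^ Suc n * 1 \<le> (1 * \<rho> ^ Suc n) * (real (Suc n) * vabs (of_nat (Suc n) :: 'c))"
    using assms \<open>0 \<le> \<rho>\<close> by (intro mult_mono power_mono) auto
  thus ?thesis
    using vabs_of_nat_ge[of "Suc n"]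
    by (simp add: vabs_mult vabs_divide vabs_power divide_le_eq mult_ac del: of_nat_Suc power_Suc)
qed

lemma log_bound_tendsto:
  assumes "0 \<le> \<rho>" "\<rho> < 1"
  shows "(\<lambda>n. real (Suc n) * \<rho> ^ Suc n) \<longlonglongrightarrow> 0"
  using LIMSEQ_Suc[OF powser_times_n_limit_0[of \<rho>]] assms by simp

lemma log_one_plus_sums:
  assumes "vabs (t :: 'c) < 1"
  shows "(\<lambda>n. (-1) ^ n * t ^ Suc n / of_nat (Suc n)) sums log_one_plus t"
  unfolding log_one_plus_def
proof (rule summable_sums, rule summable_vabs_bound)
  show "vabs ((-1) ^ n * t ^ Suc n / of_nat (Suc n)) \<le> real (Suc n) * vabs t ^ Suc n" for n
    by (rule vabs_log_term_le) (simp_all add: vabs_power)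
qed (use assms in \<open>simp add: log_bound_tendsto del: of_nat_Suc power_Suc\<close>)

text \<open>Each coefficient is continuous in the exponent, and the differences of the terms are
  dominated by \<open>vabs t ^ n\<close>, whatever the exponents in \<open>Zp\<close>.\<close>

lemma tendsto_one_plus_pow:
  assumes "\<And>x. f x \<in> (Zp :: 'c set)" "s \<in> Zp" "(f \<longlongrightarrow> s) F" "vabs t < 1"
  shows "((\<lambda>x. one_plus_pow (f x) t) \<longlongrightarrow> one_plus_pow s t) F"
  unfolding tendsto_vabs_iff
proof (rule order_tendstoI)
  fix e :: real assume "e > 0"
  define a where "a = (\<lambda>x n. vabs (((f x gchoose n) - (s gchoose n)) * t ^ n))"
  have "eventually (\<lambda>x. \<forall>n. a x n \<le> e / 2) F"
  proof (rule eventually_uniform_small)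
    show "((\<lambda>x. a x n) \<longlongrightarrow> 0) F" for n
    proof -
      have "((\<lambda>x. ((f x gchoose n) - (s gchoose n)) * t ^ n) \<longlongrightarrow> ((s gchoose n) - (s gchoose n)) * t ^ n) F"
        by (intro tendsto_intros tendsto_gchoose assms)
      from tendsto_vabs[OF this] show ?thesis
        by (simp add: a_def)
    qed
    have "vabs ((f x gchoose n) - (s gchoose n)) \<le> 1" for x n
      by (intro vabs_diff_le vabs_gchoose_le_one assms)
    hence "a x n \<le> vabs t ^ n" for x n
      by (simp add: a_def vabs_mult vabs_power mult_left_le_one_le)
    thus "eventually (\<lambda>x. \<forall>n. a x n \<le> vabs t ^ n) F"
      by simp
    show "(\<lambda>n. vabs t ^ n) \<longlonglongrightarrow> 0"
      using assms(4) by (intro LIMSEQ_power_zero) simp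
  qed (use \<open>e > 0\<close> in simp)
  thus "eventually (\<lambda>x. vabs (one_plus_pow (f x) t - one_plus_pow s t) < e) F"
  proof eventually_elim
    case (elim x)
    have "(\<lambda>n. ((f x gchoose n) - (s gchoose n)) * t ^ n) sums (one_plus_pow (f x) t - one_plus_pow s t)"
      using sums_diff_nonarch[OF one_plus_pow_sums[OF assms(1)[of x] assms(4)] one_plus_pow_sums[OF assms(2,4)]]
      by (simp add: algebra_simps)
    hence "vabs (one_plus_pow (f x) t - one_plus_pow s t) \<le> e / 2"
      by (rule vabs_sums_le) (use elim in \<open>simp add: a_def\<close>)
    thus ?case
      using \<open>e > 0\<close> by linarith
  qed
qed (auto intro!: always_eventually elim: less_le_trans)

text \<open>The identity is clear for \<open>s \<in> \<nat>\<close>, and \<open>\<nat>\<close> is dense in \<open>Zp\<close>.\<close>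

lemma one_plus_pow_mult:
  assumes s: "s \<in> (Zp :: 'c set)" and t: "vabs t < 1" and u: "vabs u < 1"
  shows "one_plus_pow s (t + u + t * u) = one_plus_pow s t * one_plus_pow s u"
proof -
  obtain f where f: "(\<lambda>i. of_nat (f i)) \<longlonglongrightarrow> s"
    using Zp_nat_seq[OF s] by blast
  have tu: "vabs (t + u + t * u) < 1"
    using t u by (intro vabs_add_less vabs_mult_less_one) auto
  have "(\<lambda>i. one_plus_pow (of_nat (f i)) t * one_plus_pow (of_nat (f i)) u)
           \<longlonglongrightarrow> one_plus_pow s t * one_plus_pow s u"
    by (intro tendsto_mult tendsto_one_plus_pow s f t u) simp_all
  moreover have "one_plus_pow (of_nat m) t * one_plus_pow (of_nat m) u
      = one_plus_pow (of_nat m) (t + u + t * u)" for m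
    unfolding one_plus_pow_of_nat power_mult_distrib[symmetric] by (simp add: algebra_simps)
  ultimately have "(\<lambda>i. one_plus_pow (of_nat (f i)) (t + u + t * u))
           \<longlonglongrightarrow> one_plus_pow s t * one_plus_pow s u"
    by simp
  moreover have "(\<lambda>i. one_plus_pow (of_nat (f i)) (t + u + t * u)) \<longlonglongrightarrow> one_plus_pow s (t + u + t * u)"
    by (intro tendsto_one_plus_pow s f tu) simp_all
  ultimately show ?thesis
    using LIMSEQ_unique by blast
qed

text \<open>This is Pascal's rule, compared coefficient by coefficient. It splits
  \<open>1 + t\<close> off from \<open>(1 + t)\<close> to the power \<open>1 - s\<close>.\<close>

lemma one_plus_pow_Suc:
  assumes s: "s \<in> (Zp :: 'c set)" and t: "vabs t < 1"
  shows "one_plus_pow (1 + s) t = (1 + t) * one_plus_pow s t"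
proof -
  have 1: "(\<lambda>n. t * ((s gchoose n) * t ^ n)) sums (t * one_plus_pow s t)"
    by (intro sums_mult_nonarch one_plus_pow_sums assms)
  have "(\<lambda>n. ((1 + s) gchoose Suc n) * t ^ Suc n) sums (t * one_plus_pow s t + (one_plus_pow s t - 1))"
    using sums_add[OF 1 one_plus_pow_sums_Suc[OF assms]] gbinomial_Suc_Suc[of s]
    by (simp add: algebra_simps)
  from sums_Suc[OF this] show ?thesis
    by (simp add: one_plus_pow_def sums_iff algebra_simps)
qed

text \<open>Since \<open>(s gchoose (n + 1)) = s / (n + 1) * (s - 1 gchoose n)\<close>, the difference quotient of the
  binomial series at \<open>s = 0\<close> is a series whose terms tend to those of the logarithm.\<close>

lemma one_plus_pow_deriv:
  assumes \<rho>: "0 \<le> \<rho>" "\<rho> < 1" and e: "e > 0"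
  shows "\<forall>\<^sub>F s in at 0 within (Zp :: 'c set).
           \<forall>t. vabs t \<le> \<rho> \<longrightarrow> vabs ((one_plus_pow s t - 1) / s - log_one_plus t) \<le> e"
proof -
  \<comment> \<open>This majorant of the \<open>n\<close>-th term does not mention \<open>t\<close>;
    that is where uniformity comes from.\<close>
  define a where "a = (\<lambda>(s :: 'c) n. vabs (((s - 1) gchoose n) - (-1) ^ n) * (real (Suc n) * \<rho> ^ Suc n))"
  have ev: "\<forall>\<^sub>F s in at 0 within (Zp :: 'c set). s \<in> Zp \<and> s \<noteq> 0"
    by (simp add: eventually_at_filter)
  have Zp1: "s - 1 \<in> Zp" if "s \<in> (Zp :: 'c set)" for s
    using Zp_diff[OF that of_nat_in_Zp[of 1]] by simp
  have "\<forall>\<^sub>F s in at 0 within Zp. \<forall>n. a s n \<le> e"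
  proof (rule eventually_uniform_small[OF _ _ log_bound_tendsto[OF \<rho>] e])
    fix n
    have "((\<lambda>s :: 'c. (s - 1) gchoose n) \<longlongrightarrow> (0 - 1) gchoose n) (at 0 within Zp)"
      by (intro tendsto_gchoose tendsto_intros)
    hence "((\<lambda>s :: 'c. vabs (((s - 1) gchoose n) - (-1) ^ n)) \<longlongrightarrow> 0) (at 0 within Zp)"
      by (simp add: minus_one_gchoose tendsto_vabs_iff)
    thus "((\<lambda>s. a s n) \<longlongrightarrow> 0) (at 0 within Zp)"
      unfolding a_def by (rule tendsto_mult_left_zero)
  next
    show "\<forall>\<^sub>F s in at 0 within Zp. \<forall>n. a s n \<le> real (Suc n) * \<rho> ^ Suc n"
      using ev
    proof eventually_elim
      case (elim s)
      have "vabs (((s - 1) gchoose n) - (-1) ^ n) \<le> 1" for n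
        using elim by (intro vabs_diff_le vabs_gchoose_le_one Zp1) (simp_all add: vabs_power)
      thus ?case
        using \<rho> by (auto simp: a_def intro!: mult_left_le_one_le)
    qed
  qed
  with ev show ?thesis
  proof eventually_elim
    case (elim s)
    show ?case
    proof (intro allI impI)
      fix t :: 'c assume t: "vabs t \<le> \<rho>"
      hence t1: "vabs t < 1"
        using \<rho> by linarith
      have s: "s \<in> Zp"
        using elim by simp
      from sums_diff_nonarch[OF sums_mult_nonarch[OF one_plus_pow_sums_Suc[OF s t1], of "inverse s"] log_one_plus_sums[OF t1]] elim
      have "(\<lambda>n. inverse s * ((s gchoose Suc n) * t ^ Suc n) - (-1) ^ n * t ^ Suc n / of_nat (Suc n))
              sums ((one_plus_pow s t - 1) / s - log_one_plus t)"
        by (simp add: field_simps)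
      \<comment> \<open>The factor \<open>1\<close> on the right is the \<open>c\<close> of
        \<open>vabs_log_term_le\<close>.\<close>
      moreover have "inverse s * ((s gchoose Suc n) * t ^ Suc n) - (-1) ^ n * t ^ Suc n / of_nat (Suc n)
          = (((s - 1) gchoose n) - (-1) ^ n) * (1 * t ^ Suc n / of_nat (Suc n))" for n
        using elim gbinomial_absorption'[of "Suc n" s] by (simp add: field_simps del: of_nat_Suc power_Suc)
      ultimately have "(\<lambda>n. (((s - 1) gchoose n) - (-1) ^ n) * (1 * t ^ Suc n / of_nat (Suc n)))
              sums ((one_plus_pow s t - 1) / s - log_one_plus t)"
        by (simp only:)
      thus "vabs ((one_plus_pow s t - 1) / s - log_one_plus t) \<le> e"
      proof (rule vabs_sums_le)
        fix n
        have "vabs ((((s - 1) gchoose n) - (-1) ^ n) * (1 * t ^ Suc n / of_nat (Suc n))) \<le> a s n"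
          unfolding a_def vabs_mult[of "_ - _"]
          by (intro mult_left_mono vabs_log_term_le t) simp_all
        thus "vabs ((((s - 1) gchoose n) - (-1) ^ n) * (1 * t ^ Suc n / of_nat (Suc n))) \<le> e"
          using elim by (meson order_trans)
      qed
    qed
  qed
qed

lemma tendsto_log_one_plus:
  assumes "vabs (t :: 'c) < 1"
  shows "((\<lambda>s. (one_plus_pow s t - 1) / s) \<longlongrightarrow> log_one_plus t) (at 0 within Zp)"
  unfolding tendsto_vabs_iff
proof (rule order_tendstoI)
  fix e :: real assume "e > 0"
  hence "\<forall>\<^sub>F s in at 0 within (Zp :: 'c set).
           \<forall>u. vabs u \<le> vabs t \<longrightarrow> vabs ((one_plus_pow s u - 1) / s - log_one_plus u) \<le> e / 2"
    using assms by (intro one_plus_pow_deriv) auto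
  thus "\<forall>\<^sub>F s in at 0 within Zp. vabs ((one_plus_pow s t - 1) / s - log_one_plus t) < e"
    by eventually_elim (use \<open>e > 0\<close> in fastforce)
qed (auto intro!: always_eventually elim: less_le_trans)

text \<open>With \<open>q = (X - 1) / s\<close> and \<open>q' = (X' - 1) / s\<close>,
  multiplicativity of the powers gives \<open>(X * X' - 1) / s = s * q * q' + q + q'\<close>. As
  \<open>s\<close> tends to 0 the quotients become logarithms and the product term vanishes.\<close>

lemma log_one_plus_mult:
  assumes t: "vabs (t :: 'c) < 1" and u: "vabs u < 1"
  shows "log_one_plus (t + u + t * u) = log_one_plus t + log_one_plus u"
proof -
  let ?F = "at 0 within (Zp :: 'c set)"
  let ?q = "\<lambda>t s. (one_plus_pow s t - 1) / s"
  have tu: "vabs (t + u + t * u) < 1"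
    using t u by (intro vabs_add_less vabs_mult_less_one) auto
  have "((\<lambda>s. s * ?q t s * ?q u s + ?q t s + ?q u s) \<longlongrightarrow>
          0 * log_one_plus t * log_one_plus u + log_one_plus t + log_one_plus u) ?F"
    by (intro tendsto_intros tendsto_log_one_plus t u)
  moreover have "\<forall>\<^sub>F s in ?F. s * ?q t s * ?q u s + ?q t s + ?q u s = ?q (t + u + t * u) s"
  proof -
    have "\<forall>\<^sub>F s in ?F. s \<in> Zp \<and> s \<noteq> 0"
      by (simp add: eventually_at_filter)
    thus ?thesis
      by eventually_elim (simp only: one_plus_pow_mult t u, simp add: field_simps)
  qed
  ultimately have "(?q (t + u + t * u) \<longlongrightarrow> log_one_plus t + log_one_plus u) ?F"
    using Lim_transform_eventually by force
  thus ?thesis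
    using tendsto_unique[OF zero_limit_point_Zp(2) tendsto_log_one_plus[OF tu]] by blast
qed

end

subsection \<open>The residue field and roots of unity\<close>

context padic_field
begin

text \<open>In the binomial expansion of \<open>x ^ p\<close> with \<open>x = z + y\<close>, all
  terms strictly between the ends carry a coefficient divisible by \<open>p\<close> and at least one
  factor \<open>z = x - y\<close>.\<close>

lemma vabs_frobenius_diff:
  assumes "vabs (x :: 'c) \<le> 1" "vabs y \<le> 1"
  shows "vabs (x ^ p - y ^ p - (x - y) ^ p) \<le> vabs (x - y) / real p"
proof -
  define z where "z = x - y"
  have z: "vabs z \<le> 1"
    unfolding z_def by (rule vabs_diff_le) (use assms in auto)
  let ?t = "\<lambda>k. of_nat (p choose k) * z ^ k * y ^ (p - k)"
  have "{..p} = insert 0 (insert p {1..<p})"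
    using p_gt_1 by auto
  moreover have "x ^ p = (\<Sum>k\<le>p. ?t k)"
    unfolding binomial_ring[symmetric] by (simp add: z_def)
  ultimately have "x ^ p = ?t 0 + (?t p + (\<Sum>k\<in>{1..<p}. ?t k))"
    using p_gt_1 by simp
  hence eq: "x ^ p - y ^ p - z ^ p = (\<Sum>k\<in>{1..<p}. ?t k)"
    by simp
  have "vabs (?t k) \<le> vabs z / real p" if k: "k \<in> {1..<p}" for k
  proof -
    have "p dvd (p choose k)"
      using k prime_p by (intro dvd_choose_prime) auto
    hence "vabs (of_nat (p choose k) :: 'c) \<le> 1 / real p"
      using vabs_of_int_dvd[of "int (p choose k)"] by simp
    moreover have "vabs z ^ k \<le> vabs z ^ 1"
      using k z by (intro power_decreasing) auto
    moreover have "vabs y ^ (p - k) \<le> 1"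
      using assms by (intro power_le_one) auto
    ultimately have "vabs (of_nat (p choose k) :: 'c) * vabs z ^ k * vabs y ^ (p - k) \<le> (1 / real p) * vabs z * 1"
      by (intro mult_mono) auto
    thus ?thesis
      by (simp add: vabs_mult vabs_power)
  qed
  thus ?thesis
    unfolding z_def[symmetric] eq by (intro vabs_sum_le) auto
qed

text \<open>Frobenius is injective on the residue field: modulo the maximal ideal
  \<open>x ^ p - y ^ p\<close> equals \<open>(x - y) ^ p\<close>, so the latter is small, and then
  so is \<open>x - y\<close>.\<close>

lemma vabs_frobenius_inj:
  assumes "vabs (x :: 'c) \<le> 1" "vabs y \<le> 1" "vabs (x ^ p ^ n - y ^ p ^ n) < 1"
  shows "vabs (x - y) < 1"
  using assms
proof (induction n arbitrary: x y)
  case (Suc n)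
  have le: "vabs (x ^ p) \<le> 1" "vabs (y ^ p) \<le> 1"
    using Suc.prems(1,2) by (auto simp: vabs_power intro: power_le_one)
  have "vabs (x ^ p - y ^ p) < 1"
    by (rule Suc.IH) (use le Suc.prems(3) in \<open>simp_all flip: power_mult\<close>)
  moreover have xy: "vabs (x - y) \<le> 1"
    using Suc.prems(1,2) by (rule vabs_diff_le)
  have "vabs (x ^ p - y ^ p - (x - y) ^ p) < 1"
    using vabs_frobenius_diff[OF Suc.prems(1,2)] vabs_p_less_one xy
      divide_right_mono[OF xy, of "real p"] by simp
  ultimately have "vabs ((x ^ p - y ^ p) - (x ^ p - y ^ p - (x - y) ^ p)) < 1"
    by (rule vabs_diff_less)
  hence "vabs (x - y) ^ p < 1"
    by (simp add: vabs_power)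
  thus ?case
    using one_le_power[of "vabs (x - y)" p] by linarith
qed simp

text \<open>One step gives at most the larger of \<open>vabs (x - y) ^ p\<close> and
  \<open>vabs (x - y) / p\<close>, hence at most \<open>\<kappa> * vabs (x - y)\<close>. Choosing
  \<open>\<kappa> < 1\<close> yields convergence, while \<open>\<kappa> = 1\<close> says that
  Frobenius does not increase distances.\<close>

lemma vabs_frobenius_contract:
  assumes "vabs (x :: 'c) \<le> 1" "vabs y \<le> 1" "vabs (x - y) \<le> \<kappa>" "1 / real p \<le> \<kappa>" "\<kappa> \<le> 1"
  shows "vabs (x ^ p ^ n - y ^ p ^ n) \<le> \<kappa> ^ n * vabs (x - y)"
  using assms(1-3)
proof (induction n arbitrary: x y)
  case (Suc n)
  have le: "vabs (x ^ p) \<le> 1" "vabs (y ^ p) \<le> 1"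
    using Suc.prems(1,2) by (auto simp: vabs_power intro: power_le_one)
  have "0 \<le> \<kappa>"
    using Suc.prems(3) vabs_nonneg[of "x - y"] by linarith
  have "vabs (x - y) ^ p \<le> vabs (x - y) ^ 2"
    using p_gt_1 Suc.prems vabs_diff_le[of x 1 y] by (intro power_decreasing) auto
  also have "\<dots> \<le> \<kappa> * vabs (x - y)"
    using Suc.prems(3) by (simp add: power2_eq_square mult_right_mono)
  finally have 1: "vabs ((x - y) ^ p) \<le> \<kappa> * vabs (x - y)"
    by (simp add: vabs_power)
  have 2: "vabs (x ^ p - y ^ p - (x - y) ^ p) \<le> \<kappa> * vabs (x - y)"
    using vabs_frobenius_diff[OF Suc.prems(1,2)] mult_right_mono[OF assms(4), of "vabs (x - y)"]
    by simp
  have *: "vabs (x ^ p - y ^ p) \<le> \<kappa> * vabs (x - y)"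
    using vabs_add_le[OF 1 2] by simp
  also have "\<dots> \<le> \<kappa> * 1"
    using Suc.prems vabs_diff_le[of x 1 y] \<open>0 \<le> \<kappa>\<close> by (intro mult_left_mono) auto
  finally have "vabs ((x ^ p) ^ p ^ n - (y ^ p) ^ p ^ n) \<le> \<kappa> ^ n * vabs (x ^ p - y ^ p)"
    by (intro Suc.IH le) simp
  also have "\<dots> \<le> \<kappa> ^ n * (\<kappa> * vabs (x - y))"
    using * \<open>0 \<le> \<kappa>\<close> by (intro mult_left_mono) auto
  finally show ?case
    by (simp add: mult_ac flip: power_mult)
qed simp

end

section \<open>Value group and residue field of the \<open>p\<close>-adic complex numbers\<close>

locale Cp_field = padic_field p T for p and T :: "'c::complete_nonarch_field itself" +
  assumes Cp: "is_Cp p T"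
begin

lemma Qp_bar_dense:
  assumes "e > 0"
  shows "\<exists>y\<in>Qp_bar. vabs (y - x :: 'c) < e"
proof -
  have "x \<in> closure Qp_bar"
    using Cp by (simp add: is_Cp_def)
  thus ?thesis
    using assms unfolding closure_approachable by (auto simp: dist_vabs)
qed

lemma Qp_near_Rats:
  assumes "x \<in> (Qp :: 'c set)" "e > 0"
  shows "\<exists>y\<in>\<rat>. vabs (y - x) < e"
  using assms unfolding Qp_def closure_approachable by (auto simp: dist_vabs)

lemma vabs_Qp_nonzero:
  assumes "x \<in> (Qp :: 'c set)" "x \<noteq> 0"
  shows "\<exists>j. vabs x = real p powr of_int j"
proof -
  obtain y where y: "y \<in> \<rat>" "vabs (y - x) < vabs x"
    using Qp_near_Rats[OF assms(1), of "vabs x"] assms(2) by auto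
  hence "vabs y = vabs x"
    by (intro vabs_eq_of_close)
  thus ?thesis
    using vabs_Rats_nonzero[OF y(1)] assms(2) by (metis vabs_eq_0_iff)
qed

text \<open>Two of the nonzero terms of a vanishing sum have the same absolute value.\<close>

lemma vabs_Qp_bar_nonzero:
  assumes "x \<in> (Qp_bar :: 'c set)" "x \<noteq> 0"
  shows "\<exists>r. vabs x = real p powr (- of_rat r)"
proof -
  obtain q where q: "q \<noteq> 0" "\<And>i. coeff q i \<in> Qp" "poly q x = 0"
    using assms(1) unfolding Qp_bar_def by blast
  let ?t = "\<lambda>i. coeff q i * x ^ i"
  have "Max ((\<lambda>i. vabs (?t i)) ` {..degree q}) \<in> (\<lambda>i. vabs (?t i)) ` {..degree q}"
    by (intro Max_in) auto
  then obtain i where i': "i \<le> degree q" "Max ((\<lambda>i. vabs (?t i)) ` {..degree q}) = vabs (?t i)"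
    by (elim imageE) simp
  have i: "i \<le> degree q" "\<And>j. j \<le> degree q \<Longrightarrow> vabs (?t j) \<le> vabs (?t i)"
    unfolding i'(2)[symmetric] using i'(1) by (auto intro!: Max_ge)
  have "vabs (?t (degree q)) > 0"
    using q(1) assms(2) by simp
  hence M: "vabs (?t i) > 0"
    using i(2)[of "degree q"] by linarith
  \<comment> \<open>A single strictly dominant term could not be cancelled by the others.\<close>
  have "\<exists>j\<in>{..degree q} - {i}. vabs (?t j) = vabs (?t i)"
  proof (rule ccontr)
    assume "\<not> ?thesis"
    hence "vabs (\<Sum>j\<in>{..degree q} - {i}. ?t j) < vabs (?t i)"
      using i(2) M by (intro vabs_sum_less) (auto simp: order.not_eq_order_implies_strict)
    moreover have "?t i + (\<Sum>j\<in>{..degree q} - {i}. ?t j) = 0"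
      using q(3) i(1) sum.remove[of "{..degree q}" i ?t] by (simp add: poly_altdef)
    hence "(\<Sum>j\<in>{..degree q} - {i}. ?t j) = - ?t i"
      by (simp add: eq_neg_iff_add_eq_0 add.commute)
    ultimately show False
      by simp
  qed
  then obtain j where j: "j \<noteq> i" "vabs (?t j) = vabs (?t i)"
    by blast
  obtain a b where ab: "vabs (coeff q i) = real p powr of_int a" "vabs (coeff q j) = real p powr of_int b"
    using vabs_Qp_nonzero[OF q(2)] M j(2) by (metis mult_zero_left less_irrefl vabs_zero)
  let ?l = "ln (vabs x)"
  \<comment> \<open>As \<open>i\<close> and \<open>j\<close> differ, taking logarithms shows that
    \<open>ln (vabs x)\<close> is a rational multiple of \<open>ln p\<close>.\<close>
  have "real p powr of_int a * vabs x ^ i = real p powr of_int b * vabs x ^ j"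
    using j(2) ab by (simp add: vabs_mult vabs_power)
  from arg_cong[OF this, of ln] have "of_int a * ln (real p) + real i * ?l = of_int b * ln (real p) + real j * ?l"
    using assms(2) p_gt_1 by (simp add: ln_mult_pos ln_powr ln_realpow)
  hence "(real i - real j) * ?l = of_int (b - a) * ln (real p)"
    by (simp add: algebra_simps)
  hence "?l = of_int (b - a) / (real i - real j) * ln (real p)"
    using j(1) by (simp add: field_simps)
  also have "of_int (b - a) / (real i - real j) = - of_rat (of_int (a - b) / (of_nat i - of_nat j))"
    by (simp add: of_rat_divide of_rat_diff minus_divide_left)
  finally have "?l = - of_rat (of_int (a - b) / (of_nat i - of_nat j)) * ln (real p)" .
  hence "vabs x = real p powr (- of_rat (of_int (a - b) / (of_nat i - of_nat j)))"
    using assms(2) p_gt_1 exp_ln[of "vabs x"] by (simp add: powr_def)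
  thus ?thesis
    by blast
qed

lemma vabs_nonzero:
  assumes "x \<noteq> (0 :: 'c)"
  shows "\<exists>r. vabs x = real p powr (- of_rat r)"
proof -
  obtain y where y: "y \<in> Qp_bar" "vabs (y - x) < vabs x"
    using Qp_bar_dense[of "vabs x" x] assms by auto
  hence "vabs y = vabs x"
    by (intro vabs_eq_of_close)
  thus ?thesis
    using vabs_Qp_bar_nonzero[OF y(1)] assms by (metis vabs_eq_0_iff)
qed

text \<open>The residue class of \<open>x\<close> is a root of a monic polynomial with integer
  coefficients. It arises from an equation of \<open>x\<close> over \<open>Qp\<close> by scaling the
  largest coefficient to 1 and replacing the others by nearby integers.\<close>

lemma Qp_bar_integral_mod:
  assumes x: "x \<in> (Qp_bar :: 'c set)" "vabs x \<le> 1"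
  shows "\<exists>d n. vabs (x ^ d + (\<Sum>i<d. of_int (n i) * x ^ i)) < 1"
proof -
  obtain q where q: "q \<noteq> 0" "\<And>i. coeff q i \<in> Qp" "poly q x = 0"
    using x(1) unfolding Qp_bar_def by blast
  define I where "I = {..degree q}"
  define M where "M = Max ((\<lambda>i. vabs (coeff q i)) ` I)"
  have M: "vabs (coeff q i) \<le> M" if "i \<in> I" for i
    using that unfolding M_def I_def by (intro Max_ge) auto
  have "M > 0"
    using M[of "degree q"] q(1) by (auto simp: I_def intro: less_le_trans[rotated])
  define J where "J = {i \<in> I. vabs (coeff q i) = M}"
  have "M \<in> (\<lambda>i. vabs (coeff q i)) ` I"
    unfolding M_def I_def by (intro Max_in) auto
  hence J: "J \<noteq> {}" "finite J"
    by (auto simp: J_def I_def)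
  \<comment> \<open>Taking the last index of maximal absolute value makes all higher coefficients
    vanish in the residue field after scaling, so the reduced polynomial is monic of degree
    \<open>d\<close>.\<close>
  define d where "d = Max J"
  have "d \<in> J" and dmax: "\<And>i. i \<in> J \<Longrightarrow> i \<le> d"
    unfolding d_def using J by auto
  hence d: "d \<in> I" "vabs (coeff q d) = M"
    by (auto simp: J_def)
  have big: "vabs (coeff q i) < M" if "i \<in> I" "i > d" for i
    using M[OF that(1)] dmax[of i] that by (force simp: J_def)
  \<comment> \<open>Integers approximate quotients of rationals by \<open>Rats_near_int\<close>; an
    error below \<open>M\<close> in the coefficients becomes an error below 1 after scaling.\<close>
  have "\<exists>y\<in>\<rat>. vabs (y - coeff q i) < M" for i
    using Qp_near_Rats[OF q(2) \<open>M > 0\<close>] .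
  then obtain a where a: "\<And>i. a i \<in> \<rat>" "\<And>i. vabs (a i - coeff q i) < M"
    by metis
  have ad: "vabs (a d) = M"
    using vabs_eq_of_close[of "a d" "coeff q d"] a(2) d(2) by simp
  have a_le: "vabs (a i) \<le> M" if "i \<in> I" for i
    using vabs_add_le[of "a i - coeff q i" M "coeff q i"] a(2)[of i] M[OF that] by simp
  have a_less: "vabs (a i) < M" if "i \<in> I" "i > d" for i
    using vabs_add_less[of "a i - coeff q i" M "coeff q i"] a(2)[of i] big[OF that] by simp
  define b where "b i = a i / a d" for i
  have vb: "vabs (b i) = vabs (a i) / M" for i
    by (simp add: b_def vabs_divide ad)
  have "\<exists>k. vabs (b i - of_int k) < 1" if "i \<in> I" for i
    using a(1) a_le[OF that] \<open>M > 0\<close> unfolding b_def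
    by (intro Rats_near_int) (simp_all add: vb[unfolded b_def])
  then obtain n where n: "\<And>i. i \<in> I \<Longrightarrow> vabs (b i - of_int (n i)) < 1"
    by metis
  have "b d = 1"
    using ad \<open>M > 0\<close> by (auto simp: b_def)
  have xp: "vabs (x ^ i) \<le> 1" for i
    using x(2) by (simp add: vabs_power power_le_one)
  have "a d * (\<Sum>i\<in>I. b i * x ^ i) = (\<Sum>i\<in>I. a i * x ^ i)"
    using ad \<open>M > 0\<close> by (auto simp: b_def sum_distrib_left intro!: sum.cong)
  also have "\<dots> = (\<Sum>i\<in>I. (a i - coeff q i) * x ^ i)"
    using q(3) by (simp add: poly_altdef I_def algebra_simps sum_subtractf)
  finally have "a d * (\<Sum>i\<in>I. b i * x ^ i) = (\<Sum>i\<in>I. (a i - coeff q i) * x ^ i)" .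
  moreover have "vabs ((a i - coeff q i) * x ^ i) < M" for i
    using a(2)[of i] xp[of i] mult_right_le_one_le[of "vabs (a i - coeff q i)" "vabs (x ^ i)"]
    by (simp add: vabs_mult)
  hence "vabs (\<Sum>i\<in>I. (a i - coeff q i) * x ^ i) < M"
    using \<open>M > 0\<close> by (intro vabs_sum_less)
  ultimately have "M * vabs (\<Sum>i\<in>I. b i * x ^ i) < M * 1"
    by (metis ad vabs_mult mult.right_neutral)
  hence 1: "vabs (\<Sum>i\<in>I. b i * x ^ i) < 1"
    using \<open>M > 0\<close> by simp
  have 2: "vabs (\<Sum>i<d. (b i - of_int (n i)) * x ^ i) < 1"
    using d(1) n xp by (intro vabs_sum_less) (auto simp: I_def mult.commute[of _ "x ^ _"] intro!: vabs_mult_less_one)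
  have 3: "vabs (\<Sum>i\<in>{d<..degree q}. b i * x ^ i) < 1"
    using a_less \<open>M > 0\<close> xp
    by (intro vabs_sum_less) (auto simp: I_def vb mult.commute[of _ "x ^ _"] intro!: vabs_mult_less_one)
  have "I = insert d ({..<d} \<union> {d<..degree q})"
    using d(1) by (auto simp: I_def)
  moreover have "(\<Sum>i\<in>{..<d} \<union> {d<..degree q}. b i * x ^ i)
      = (\<Sum>i<d. b i * x ^ i) + (\<Sum>i\<in>{d<..degree q}. b i * x ^ i)"
    by (rule sum.union_disjoint) auto
  ultimately have "(\<Sum>i\<in>I. b i * x ^ i) = x ^ d + ((\<Sum>i<d. b i * x ^ i) + (\<Sum>i\<in>{d<..degree q}. b i * x ^ i))"
    using \<open>b d = 1\<close> by simp
  hence "x ^ d + (\<Sum>i<d. of_int (n i) * x ^ i) = (\<Sum>i\<in>I. b i * x ^ i)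
      - (\<Sum>i<d. (b i - of_int (n i)) * x ^ i) - (\<Sum>i\<in>{d<..degree q}. b i * x ^ i)"
    by (simp add: algebra_simps sum_subtractf)
  also have "vabs \<dots> < 1"
    by (intro vabs_diff_less 1 2 3)
  finally show ?thesis
    by blast
qed

text \<open>The residue field is algebraic over the field with \<open>p\<close> elements: the residue classes of the
  powers of \<open>u\<close> lie in the span of finitely many of them, which is finite, and Frobenius is
  injective.\<close>

lemma frobenius_periodic:
  assumes u: "vabs (u :: 'c) \<le> 1"
  shows "\<exists>f>0. vabs (u ^ p ^ f - u) < 1"
proof -
  obtain x where x: "x \<in> Qp_bar" "vabs (x - u) < 1"
    using Qp_bar_dense[of 1 u] by auto
  have x1: "vabs x \<le> 1"
    using vabs_add_le[of "x - u" 1 u] x(2) u by simp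
  obtain d n where dn: "vabs (x ^ d + (\<Sum>i<d. of_int (n i) * x ^ i)) < 1"
    using Qp_bar_integral_mod[OF x(1) x1] by blast
  \<comment> \<open>In degree 0 the relation would read \<open>vabs 1 < 1\<close>.\<close>
  have "d \<noteq> 0"
    using dn by (intro notI) simp
  then obtain m where m: "d = Suc m"
    by (cases d) auto
  have "\<exists>c :: nat \<Rightarrow> int. vabs (x ^ k - (\<Sum>i<d. of_int (c i) * x ^ i)) < 1" for k
  proof (induction k)
    case 0
    show ?case
      by (rule exI[of _ "\<lambda>i. if i = 0 then 1 else 0"]) (simp add: m sum.lessThan_Suc_shift del: sum.lessThan_Suc)
  next
    case (Suc k)
    then obtain c :: "nat \<Rightarrow> int" where c: "vabs (x ^ k - (\<Sum>i<d. of_int (c i) * x ^ i)) < 1"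
      by blast
    \<comment> \<open>Multiplication by \<open>x\<close> shifts the coefficients; the overflow
      \<open>c m * x ^ d\<close> is removed with the monic relation.\<close>
    define c' where "c' i = (if i = 0 then 0 else c (i - 1)) - c m * n i" for i
    have "(\<Sum>i<d. of_int (if i = 0 then 0 else c (i - 1)) * x ^ i) = x * (\<Sum>i<m. of_int (c i) * x ^ i)"
      by (simp add: m sum.lessThan_Suc_shift sum_distrib_left mult_ac del: sum.lessThan_Suc)
    moreover have "(\<Sum>i<d. of_int (c i) * x ^ i) = (\<Sum>i<m. of_int (c i) * x ^ i) + of_int (c m) * x ^ m"
      by (simp add: m)
    moreover have "(\<Sum>i<d. of_int (c' i) * x ^ i) = (\<Sum>i<d. of_int (if i = 0 then 0 else c (i - 1)) * x ^ i)
        - of_int (c m) * (\<Sum>i<d. of_int (n i) * x ^ i)"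
      by (simp add: c'_def left_diff_distrib sum_subtractf sum_distrib_left mult.assoc del: sum.lessThan_Suc)
    ultimately have "x ^ Suc k - (\<Sum>i<d. of_int (c' i) * x ^ i) = x * (x ^ k - (\<Sum>i<d. of_int (c i) * x ^ i))
        + of_int (c m) * (x ^ d + (\<Sum>i<d. of_int (n i) * x ^ i))"
      by (simp add: m algebra_simps)
    also have "vabs \<dots> < 1"
      by (intro vabs_add_less vabs_mult_less_one x1 c dn vabs_of_int_le_one)
    finally show ?case
      by blast
  qed
  then obtain c :: "nat \<Rightarrow> nat \<Rightarrow> int" where c: "vabs (x ^ k - (\<Sum>i<d. of_int (c k i) * x ^ i)) < 1" for k
    by metis
  \<comment> \<open>Only the coefficients modulo \<open>p\<close> matter for the residue class, and
    restriction to \<open>{..<d}\<close> leaves finitely many functions; the pigeonhole principle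
    then gives two Frobenius powers of \<open>x\<close> with equal residue.\<close>
  define g where "g k = restrict (\<lambda>i. c (p ^ k) i mod int p) {..<d}" for k
  have "range g \<subseteq> PiE {..<d} (\<lambda>_. {0..<int p})"
    using p_gt_1 by (auto simp: g_def PiE_iff extensional_def split: if_splits)
  hence "finite (range g)"
    by (rule finite_subset) (intro finite_PiE; simp)
  hence "\<not> inj g"
    using finite_imageD infinite_UNIV_nat by blast
  then obtain i j where ij: "i < j" "g i = g j"
    unfolding inj_def by (metis nat_neq_iff)
  have "vabs (x ^ p ^ i - x ^ p ^ j) < 1"
  proof -
    have "int p dvd c (p ^ i) l - c (p ^ j) l" if "l < d" for l
      using fun_cong[OF ij(2), of l] that by (simp add: g_def mod_eq_dvd_iff)
    hence "vabs (of_int (c (p ^ i) l - c (p ^ j) l) * x ^ l) < 1" if "l < d" for l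
      using vabs_of_int_dvd[of "c (p ^ i) l - c (p ^ j) l"] that vabs_p_less_one x1
      by (subst mult.commute, intro vabs_mult_less_one) (auto simp: vabs_power power_le_one simp del: of_int_diff)
    hence "vabs (\<Sum>l<d. of_int (c (p ^ i) l - c (p ^ j) l) * x ^ l) < 1"
      by (intro vabs_sum_less) auto
    hence "vabs ((x ^ p ^ i - (\<Sum>l<d. of_int (c (p ^ i) l) * x ^ l)) - (x ^ p ^ j - (\<Sum>l<d. of_int (c (p ^ j) l) * x ^ l))
        + (\<Sum>l<d. of_int (c (p ^ i) l - c (p ^ j) l) * x ^ l)) < 1"
      by (intro vabs_add_less vabs_diff_less c)
    thus ?thesis
      by (simp add: algebra_simps sum_subtractf)
  qed
  moreover have "x ^ p ^ j = (x ^ p ^ (j - i)) ^ p ^ i"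
    using ij(1) by (simp flip: power_mult power_add)
  ultimately have "vabs (x ^ p ^ i - (x ^ p ^ (j - i)) ^ p ^ i) < 1"
    by (simp only:)
  moreover have "vabs (x ^ p ^ (j - i)) \<le> 1"
    using x1 by (simp add: vabs_power power_le_one)
  ultimately have "vabs (x - x ^ p ^ (j - i)) < 1"
    using x1 vabs_frobenius_inj[of x "x ^ p ^ (j - i)" i] by blast
  \<comment> \<open>Periodicity passes from the algebraic approximation \<open>x\<close> back to
    \<open>u\<close>.\<close>
  moreover have "vabs (x ^ p ^ (j - i) - u ^ p ^ (j - i)) < 1"
  proof -
    have "vabs (x ^ p ^ (j - i) - u ^ p ^ (j - i)) \<le> 1 ^ (j - i) * vabs (x - u)"
      using x u x1 p_gt_1 by (intro vabs_frobenius_contract) auto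
    thus ?thesis
      using x(2) by simp
  qed
  ultimately have "vabs ((x - x ^ p ^ (j - i)) + (x ^ p ^ (j - i) - u ^ p ^ (j - i)) - (x - u)) < 1"
    using x(2) by (meson vabs_add_less vabs_diff_less)
  hence "vabs (u ^ p ^ (j - i) - u) < 1"
    by (simp add: vabs_minus_commute)
  thus ?thesis
    using ij(1) by (intro exI[of _ "j - i"]) simp
qed

end

subsection \<open>The Iwasawa logarithm\<close>

text \<open>Additive maps on the rationals are linear over them, so they are determined by the value
  at 1. This settles both \<open>vabs (ppow r)\<close> and the logarithm of
  \<open>ppow r\<close>.\<close>

lemma additive_rat_eq_0:
  fixes D :: "rat \<Rightarrow> 'a::field_char_0"
  assumes add: "\<And>r s. D (r + s) = D r + D s" and one: "D 1 = 0"
  shows "D r = 0"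
proof -
  have zero: "D 0 = 0"
    using add[of 0 0] by simp
  have mult: "D (of_nat n * s) = of_nat n * D s" for n s
    by (induction n) (simp_all add: zero add distrib_right)
  have neg: "D (- s) = - D s" for s
    using add[of s "- s"] zero by (simp add: eq_neg_iff_add_eq_0 add.commute)
  have nat: "D (of_nat n) = 0" for n
    using mult[of n 1] one by simp
  have int: "D (of_int k) = 0" for k
    by (cases k rule: int_cases2) (simp_all add: nat neg)
  obtain a b where ab: "r = Rat.Fract a b" "b > 0"
    by (cases r) auto
  hence "of_nat (nat b) * r = of_int a"
    by (simp add: Fract_of_int_quotient)
  hence "of_nat (nat b) * D r = 0"
    using mult[of "nat b" r] int[of a] by simp
  thus ?thesis
    using ab(2) by simp
qed

context Cp_field
begin

text \<open>The limit in \<open>hat\<close>, detached from the passage to the unit part: the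
  Teichmueller representative.\<close>

definition teich :: "'c \<Rightarrow> 'c" where
  "teich u = lim (\<lambda>n. u ^ p ^ fact n)"

text \<open>Let \<open>f\<close> be a Frobenius period of the residue class of \<open>u\<close>.
  From \<open>n = f\<close> on, \<open>f\<close> divides \<open>fact n\<close>, so all these powers
  of \<open>u\<close> stay in its residue class, and the contraction estimate makes consecutive ones
  approach each other.\<close>

lemma
  assumes u: "vabs (u :: 'c) \<le> 1"
  shows teich_tendsto: "(\<lambda>n. u ^ p ^ fact n) \<longlonglongrightarrow> teich u"
    and vabs_teich_diff: "vabs (teich u - u) < 1"
proof -
  obtain f where f: "f > 0" "vabs (u ^ p ^ f - u) < 1"
    using frobenius_periodic[OF u] by blast
  define \<kappa> where "\<kappa> = max (vabs (u ^ p ^ f - u)) (1 / real p)"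
  have \<kappa>: "0 \<le> \<kappa>" "\<kappa> < 1" "1 / real p \<le> \<kappa>" "vabs (u ^ p ^ f - u) \<le> \<kappa>"
    using f(2) vabs_p_less_one by (auto simp: \<kappa>_def le_max_iff_disj)
  have le: "vabs (u ^ n) \<le> 1" for n
    using u by (simp add: vabs_power power_le_one)
  have period: "vabs (u ^ p ^ (f * n) - u) \<le> \<kappa>" for n
  proof (induction n)
    case (Suc n)
    have "vabs ((u ^ p ^ f) ^ p ^ (f * n) - u ^ p ^ (f * n)) \<le> \<kappa> ^ (f * n) * vabs (u ^ p ^ f - u)"
      using \<kappa> u le by (intro vabs_frobenius_contract) auto
    also have "\<dots> \<le> 1 * \<kappa>"
      using \<kappa> by (intro mult_mono power_le_one) auto
    finally have "vabs (u ^ p ^ (f * Suc n) - u ^ p ^ (f * n)) \<le> \<kappa>"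
      by (simp add: power_add flip: power_mult)
    thus ?case
      using Suc vabs_diff_trans[of "u ^ p ^ (f * Suc n)" u "u ^ p ^ (f * n)"] by linarith
  qed (use \<kappa> in simp)
  have period': "vabs (u ^ p ^ n - u) \<le> \<kappa>" if "f dvd n" for n
    using period that by (metis dvdE)
  have dvd: "f dvd fact n" if "n \<ge> f" for n
    using that f(1) by (intro dvd_fact) auto
  have step: "vabs (u ^ p ^ fact (Suc n) - u ^ p ^ fact n) \<le> \<kappa> ^ n" if "n \<ge> f" for n
  proof -
    \<comment> \<open>As \<open>fact (Suc n) = n * fact n + fact n\<close>, the difference is a
      \<open>fact n\<close>-fold Frobenius applied to two elements with the same residue.\<close>
    have "vabs ((u ^ p ^ (n * fact n)) ^ p ^ fact n - u ^ p ^ fact n) \<le> \<kappa> ^ fact n * vabs (u ^ p ^ (n * fact n) - u)"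
      using \<kappa> u le dvd[OF that] by (intro vabs_frobenius_contract period') auto
    also have "\<dots> \<le> \<kappa> ^ n * 1"
      using \<kappa> u le fact_ge_self[of n]
      by (intro mult_mono power_decreasing vabs_diff_le) auto
    finally show ?thesis
      by (simp add: power_add mult.commute[of "p ^ fact n"] flip: power_mult)
  qed
  have "(\<lambda>n. vabs (u ^ p ^ fact (Suc n) - u ^ p ^ fact n)) \<longlonglongrightarrow> 0"
    by (rule tendsto_sandwich[OF _ _ tendsto_const LIMSEQ_power_zero[of \<kappa>]])
       (use \<kappa> step in \<open>auto simp: eventually_sequentially simp del: fact_Suc\<close>)
  hence "convergent (\<lambda>n. u ^ p ^ fact n)"
    by (rule Cauchy_if_consecutive_vabs)
  thus *: "(\<lambda>n. u ^ p ^ fact n) \<longlonglongrightarrow> teich u"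
    by (simp add: teich_def convergent_LIMSEQ_iff)
  have "(\<lambda>n. u ^ p ^ fact n - u) \<longlonglongrightarrow> teich u - u"
    by (intro tendsto_intros *)
  hence "vabs (teich u - u) \<le> \<kappa>"
    by (rule vabs_lim_le) (use period' dvd in \<open>auto simp: eventually_sequentially\<close>)
  thus "vabs (teich u - u) < 1"
    using \<kappa> by linarith
qed

lemma teich_mult:
  assumes "vabs (u :: 'c) \<le> 1" "vabs v \<le> 1"
  shows "teich (u * v) = teich u * teich v"
proof -
  have "(\<lambda>n. (u * v) ^ p ^ fact n) \<longlonglongrightarrow> teich u * teich v"
    using tendsto_mult[OF teich_tendsto teich_tendsto, OF assms] by (simp add: power_mult_distrib)
  thus ?thesis
    using LIMSEQ_unique teich_tendsto[OF vabs_mult_le_one, OF assms] by blast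
qed

lemma teich_one_unit:
  assumes "vabs (u - 1 :: 'c) < 1"
  shows "teich u = 1"
proof -
  have u: "vabs u \<le> 1"
    using vabs_one_plus[OF assms] by simp
  define \<kappa> where "\<kappa> = max (vabs (u - 1)) (1 / real p)"
  have \<kappa>: "0 \<le> \<kappa>" "\<kappa> < 1" "1 / real p \<le> \<kappa>" "vabs (u - 1) \<le> \<kappa>"
    using assms vabs_p_less_one by (auto simp: \<kappa>_def le_max_iff_disj)
  have "vabs (u ^ p ^ fact n - 1) \<le> \<kappa> ^ n" for n
  proof -
    have "vabs (u ^ p ^ fact n - 1 ^ p ^ fact n) \<le> \<kappa> ^ fact n * vabs (u - 1)"
      using \<kappa> u by (intro vabs_frobenius_contract) auto
    also have "\<dots> \<le> \<kappa> ^ n * 1"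
      using \<kappa> assms fact_ge_self[of n] by (intro mult_mono power_decreasing) auto
    finally show ?thesis
      by simp
  qed
  hence "(\<lambda>n. u ^ p ^ fact n) \<longlonglongrightarrow> 1"
    by (intro tendstoI_vabs_bound[OF _ LIMSEQ_power_zero[of \<kappa>]]) (use \<kappa> in auto)
  thus ?thesis
    using LIMSEQ_unique teich_tendsto[OF u] by blast
qed

end

section \<open>Fractional powers, \<open>omega_v\<close>, \<open>angle\<close>, and the Iwasawa
  logarithm in terms of them\<close>

locale Cp_powers = Cp_field p T for p and T :: "'c::complete_nonarch_field itself" +
  fixes ppow :: "rat \<Rightarrow> 'c"
  assumes ppow: "fractional_powers p ppow"
begin

lemma ppow_add: "ppow (r + s) = ppow r * ppow s"
  using ppow by (simp add: fractional_powers_def)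

lemma ppow_one: "ppow 1 = of_nat p"
  using ppow by (simp add: fractional_powers_def)

lemma ppow_nonzero: "ppow r \<noteq> 0"
  using ppow_add[of r "1 - r"] ppow_one p_gt_1 by auto

lemma ppow_zero: "ppow 0 = 1"
  using ppow_add[of 0 0] ppow_nonzero[of 0] by simp

text \<open>The defect \<open>ln (vabs (ppow r)) + r * ln p\<close> is additive in \<open>r\<close>
  and vanishes at 1.\<close>

lemma vabs_ppow: "vabs (ppow r) = real p powr (- of_rat r)"
proof -
  have "ln (vabs (ppow r)) + of_rat r * ln (real p) = 0"
  proof (rule additive_rat_eq_0[where D = "\<lambda>r. ln (vabs (ppow r)) + of_rat r * ln (real p)"])
    show "ln (vabs (ppow (r + s))) + of_rat (r + s) * ln (real p)
        = ln (vabs (ppow r)) + of_rat r * ln (real p) + (ln (vabs (ppow s)) + of_rat s * ln (real p))" for r s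
      using ppow_nonzero[of r] ppow_nonzero[of s]
      by (simp add: ppow_add vabs_mult ln_mult_pos of_rat_add algebra_simps)
    show "ln (vabs (ppow 1)) + of_rat 1 * ln (real p) = 0"
      using p_gt_1 by (simp add: ppow_one vabs_p ln_div)
  qed
  hence "ln (vabs (ppow r)) = - of_rat r * ln (real p)"
    by simp
  hence "exp (ln (vabs (ppow r))) = exp (- of_rat r * ln (real p))"
    by simp
  thus ?thesis
    using p_gt_1 ppow_nonzero[of r] by (simp add: powr_def)
qed

lemma vp_eqI:
  assumes "vabs (a :: 'c) = real p powr (- of_rat r)"
  shows "vp p a = r"
  unfolding vp_def assms using p_gt_1 by (intro the_equality) (auto simp: powr_inj)

lemma vabs_vp:
  assumes "a \<noteq> (0 :: 'c)"
  shows "vabs a = real p powr (- of_rat (vp p a))"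
  using vabs_nonzero[OF assms] vp_eqI by blast

lemma vp_mult:
  assumes "a \<noteq> (0 :: 'c)" "b \<noteq> 0"
  shows "vp p (a * b) = vp p a + vp p b"
  by (rule vp_eqI) (simp add: vabs_mult vabs_vp assms of_rat_add flip: powr_add)

lemma vabs_unit_part:
  assumes "a \<noteq> (0 :: 'c)"
  shows "vabs (a / ppow (vp p a)) = 1"
  using vabs_vp[OF assms] p_gt_1 by (simp add: vabs_divide vabs_ppow)

lemma hat_eq_teich: "hat p ppow a = teich (a / ppow (vp p a))"
  by (simp add: hat_def teich_def)

lemma vabs_hat:
  assumes "a \<noteq> (0 :: 'c)"
  shows "vabs (hat p ppow a) = 1"
  using vabs_eq_of_close[of "hat p ppow a" "a / ppow (vp p a)"] vabs_teich_diff[of "a / ppow (vp p a)"]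
    vabs_unit_part[OF assms] by (simp add: hat_eq_teich)

lemma omega_v_nonzero:
  assumes "a \<noteq> (0 :: 'c)"
  shows "omega_v p ppow a \<noteq> 0"
  using vabs_hat[OF assms] ppow_nonzero by (auto simp: omega_v_def)

lemma omega_v_mult:
  assumes "a \<noteq> (0 :: 'c)" "b \<noteq> 0"
  shows "omega_v p ppow (a * b) = omega_v p ppow a * omega_v p ppow b"
proof -
  have "hat p ppow (a * b) = hat p ppow a * hat p ppow b"
    unfolding hat_eq_teich using vabs_unit_part assms
    by (subst teich_mult[symmetric]) (simp_all add: vp_mult ppow_add)
  thus ?thesis
    by (simp add: omega_v_def vp_mult assms ppow_add)
qed

lemma omega_v_one_unit:
  assumes "vabs (x - 1 :: 'c) < 1"
  shows "omega_v p ppow x = 1"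
proof -
  have "vabs x = 1"
    using vabs_one_plus[OF assms] by simp
  hence "vp p x = 0"
    using p_gt_1 by (intro vp_eqI) simp
  thus ?thesis
    using teich_one_unit[OF assms] by (simp add: omega_v_def hat_eq_teich ppow_zero)
qed

lemma omega_v_p: "omega_v p ppow (of_nat p :: 'c) = of_nat p"
proof -
  have "vp p (of_nat p :: 'c) = 1"
    using p_gt_1 by (intro vp_eqI) (simp add: vabs_p powr_minus divide_inverse)
  moreover have "teich 1 = 1"
    by (rule teich_one_unit) simp
  ultimately show ?thesis
    using p_gt_1 by (simp add: omega_v_def hat_eq_teich ppow_one)
qed

text \<open>The quotient \<open>x / y\<close> is congruent to 1, where \<open>omega_v\<close> is 1,
  and \<open>omega_v\<close> is multiplicative.\<close>

lemma omega_v_close: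
  assumes "vabs (x - y) < vabs (y :: 'c)"
  shows "omega_v p ppow x = omega_v p ppow y"
proof -
  have y: "y \<noteq> 0"
    using assms vabs_nonneg[of "x - y"] by (metis not_less vabs_zero)
  have x: "x \<noteq> 0"
    using vabs_eq_of_close[OF assms] y by auto
  have "x / y - 1 = (x - y) / y"
    using y by (simp add: field_simps)
  hence "vabs (x / y - 1) < 1"
    using assms y by (simp add: vabs_divide)
  thus ?thesis
    using omega_v_mult[of y "x / y"] omega_v_one_unit[of "x / y"] x y by simp
qed

lemma vabs_angle_minus_one:
  assumes "a \<noteq> (0 :: 'c)"
  shows "vabs (angle p ppow a - 1) < 1"
proof -
  have "angle p ppow a - 1 = (a / ppow (vp p a) - hat p ppow a) / hat p ppow a"
    using omega_v_nonzero[OF assms] by (simp add: angle_def omega_v_def diff_divide_distrib)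
  thus ?thesis
    using vabs_teich_diff[of "a / ppow (vp p a)"] vabs_unit_part[OF assms] vabs_hat[OF assms]
    by (simp add: vabs_divide hat_eq_teich vabs_minus_commute)
qed

lemma angle_mult:
  assumes "a \<noteq> (0 :: 'c)" "b \<noteq> 0"
  shows "angle p ppow (a * b) = angle p ppow a * angle p ppow b"
  by (simp add: angle_def omega_v_mult assms)

text \<open>Every nonzero element is, up to torsion and fractional powers of \<open>p\<close>, congruent to \<open>1\<close>.\<close>

lemma iwasawa_log_unique:
  assumes mult: "\<And>x y :: 'c. x \<noteq> 0 \<Longrightarrow> y \<noteq> 0 \<Longrightarrow> D (x * y) = D x + D y"
    and one_unit: "\<And>x. vabs (x - 1) < 1 \<Longrightarrow> D x = (0 :: 'c)"
    and p: "D (of_nat p) = 0" and a: "a \<noteq> 0"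
  shows "D a = 0"
proof -
  have D_power: "D (x ^ n) = of_nat n * D x" if "x \<noteq> 0" for x n
    by (induction n) (use that one_unit[of 1] in \<open>simp_all add: mult algebra_simps\<close>)
  have D_ppow: "D (ppow r) = 0" for r
    by (rule additive_rat_eq_0[where D = "\<lambda>r. D (ppow r)"])
       (simp_all add: ppow_add ppow_one ppow_nonzero mult p)
  define u where "u = a / ppow (vp p a)"
  have u: "vabs u = 1"
    unfolding u_def by (rule vabs_unit_part[OF a])
  hence "u \<noteq> 0"
    by auto
  obtain f where f: "f > 0" "vabs (u ^ p ^ f - u) < 1"
    using frobenius_periodic[of u] u by auto
  have pf: "p ^ f > 1"
    using f(1) p_gt_1 by (intro one_less_power)
  \<comment> \<open>Cancelling the unit \<open>u\<close> turns the Frobenius period into a power of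
    \<open>u\<close> congruent to 1, on which \<open>D\<close> vanishes; characteristic 0 then
    allows division by the exponent.\<close>
  have "u ^ p ^ f = u * u ^ (p ^ f - 1)"
    using pf by (cases "p ^ f") simp_all
  hence "u ^ p ^ f - u = u * (u ^ (p ^ f - 1) - 1)"
    by (simp add: algebra_simps)
  hence "vabs (u ^ (p ^ f - 1) - 1) < 1"
    using f(2) u by (simp add: vabs_mult)
  hence "of_nat (p ^ f - 1) * D u = 0"
    using one_unit D_power[OF \<open>u \<noteq> 0\<close>] by metis
  moreover have "(of_nat (p ^ f - 1) :: 'c) \<noteq> 0"
    using pf by (simp only: of_nat_eq_0_iff)
  ultimately have "D u = 0"
    by simp
  moreover have "a = ppow (vp p a) * u"
    using ppow_nonzero by (simp add: u_def)
  ultimately show ?thesis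
    using mult[of "ppow (vp p a)" u] D_ppow \<open>u \<noteq> 0\<close> ppow_nonzero by simp
qed

text \<open>The right-hand side satisfies the defining conditions because \<open>angle\<close> is
  multiplicative and fixes the elements congruent to 1. Uniqueness applies
  \<open>iwasawa_log_unique\<close> to the difference of two candidates.\<close>

lemma iwasawa_log_eq:
  assumes "a \<noteq> (0 :: 'c)"
  shows "iwasawa_log p a = log_one_plus (angle p ppow a - 1)"
proof -
  \<comment> \<open>The value at 0 is prescribed to meet the clause \<open>L 0 = 0\<close> of the
    description.\<close>
  define L where "L = (\<lambda>x :: 'c. if x = 0 then 0 else log_one_plus (angle p ppow x - 1))"
  define P where "P = (\<lambda>L. (\<forall>x y :: 'c. x \<noteq> 0 \<and> y \<noteq> 0 \<longrightarrow> L (x * y) = L x + L y) \<and>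
     (\<forall>x. vabs (x - 1) < 1 \<longrightarrow> (\<lambda>n. (-1) ^ n * (x - 1) ^ Suc n / of_nat (Suc n)) sums L x) \<and>
     L (of_nat p) = 0 \<and> L 0 = 0)"
  have "P L"
    unfolding P_def
  proof (intro conjI allI impI)
    fix x y :: 'c assume xy: "x \<noteq> 0 \<and> y \<noteq> 0"
    let ?t = "angle p ppow x - 1" and ?u = "angle p ppow y - 1"
    have "angle p ppow (x * y) - 1 = ?t + ?u + ?t * ?u"
      using xy by (simp add: angle_mult algebra_simps)
    hence "log_one_plus (angle p ppow (x * y) - 1) = log_one_plus ?t + log_one_plus ?u"
      using xy log_one_plus_mult[OF vabs_angle_minus_one vabs_angle_minus_one, of x y]
      by (simp only: simp_thms)
    thus "L (x * y) = L x + L y"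
      using xy by (simp add: L_def)
  next
    fix x :: 'c assume x: "vabs (x - 1) < 1"
    hence "x \<noteq> 0"
      by auto
    hence "L x = log_one_plus (x - 1)"
      using omega_v_one_unit[OF x] by (simp add: L_def angle_def)
    thus "(\<lambda>n. (-1) ^ n * (x - 1) ^ Suc n / of_nat (Suc n)) sums L x"
      using log_one_plus_sums[OF x] by (simp only:)
  next
    show "L (of_nat p) = 0"
      using p_gt_1 log_one_plus_sums[of 0] by (simp add: L_def angle_def omega_v_p log_one_plus_def)
  qed (simp add: L_def)
  moreover have "L' = L" if "P L'" for L'
  proof
    fix x
    note L = \<open>P L\<close>[unfolded P_def] and L' = that[unfolded P_def]
    show "L' x = L x"
    proof (cases "x = 0")
      case True
      thus ?thesis
        using L L' by simp
    next
      case False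
      have "L' x - L x = 0"
      proof (rule iwasawa_log_unique[where D = "\<lambda>x. L' x - L x", OF _ _ _ False])
        fix y z :: 'c assume "y \<noteq> 0" "z \<noteq> 0"
        hence "L' (y * z) = L' y + L' z" "L (y * z) = L y + L z"
          using L L' by blast+
        thus "L' (y * z) - L (y * z) = L' y - L y + (L' z - L z)"
          by simp
      next
        fix y :: 'c assume "vabs (y - 1) < 1"
        hence "L' y = L y"
          by (intro sums_unique2[OF L'[THEN conjunct2, THEN conjunct1, rule_format]
                L[THEN conjunct2, THEN conjunct1, rule_format]])
        thus "L' y - L y = 0"
          by simp
      next
        show "L' (of_nat p) - L (of_nat p) = 0"
          using L L' by simp
      qed
      thus ?thesis
        by simp
    qed
  qed
  ultimately have "(THE L. P L) = L"
    by (rule the_equality)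
  hence "iwasawa_log p = L"
    by (simp only: iwasawa_log_def P_def)
  thus ?thesis
    using assms by (simp add: L_def)
qed

end

subsection \<open>Locally analytic functions and generalized distributions\<close>

lemma DD_mono: "r \<le> r' \<Longrightarrow> DD \<sigma> r \<subseteq> DD \<sigma> r'"
  by (auto simp: DD_def)

lemma ball_subset_DD: "a \<in> \<sigma> \<Longrightarrow> ball a r \<subseteq> DD \<sigma> r"
  by (auto simp: DD_def)

lemma germ_self: "f \<in> germ \<sigma> f"
  unfolding germ_def by (auto intro: exI[of _ 1])

lemma germ_cong:
  assumes "r > 0" "\<And>z. z \<in> DD \<sigma> r \<Longrightarrow> f z = g z"
  shows "germ \<sigma> f = germ \<sigma> g"
proof -
  have "germ \<sigma> f \<subseteq> germ \<sigma> g" if "\<And>z. z \<in> DD \<sigma> r \<Longrightarrow> f z = g z" for f g :: "'a \<Rightarrow> 'a"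
  proof
    fix h assume "h \<in> germ \<sigma> f"
    then obtain r' where r': "r' > 0" "\<forall>z\<in>DD \<sigma> r'. h z = f z"
      by (auto simp: germ_def)
    have "\<forall>z\<in>DD \<sigma> (min r r'). h z = g z"
      using r'(2) that DD_mono[of "min r r'" r \<sigma>] DD_mono[of "min r r'" r' \<sigma>]
      by (metis min.cobounded1 min.cobounded2 subsetD)
    thus "h \<in> germ \<sigma> g"
      using assms(1) r'(1) unfolding germ_def by (intro CollectI exI[of _ "min r r'"]) auto
  qed
  thus ?thesis
    using assms(2) by (intro equalityI) auto
qed

lemma BB_mono:
  assumes "f \<in> BB \<sigma> r" "r' \<le> r"
  shows "f \<in> BB \<sigma> r'"
proof -
  have "ball a r' \<subseteq> ball a r" for a :: 'a
    using assms(2) by auto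
  thus ?thesis
    using assms(1) DD_mono[OF assms(2), of \<sigma>] unfolding BB_def mem_Collect_eq
    by (meson subsetD)
qed

lemma BB_cong:
  assumes "f \<in> BB \<sigma> r" "\<And>z. z \<in> DD \<sigma> r \<Longrightarrow> f z = g z"
  shows "g \<in> BB \<sigma> r"
proof -
  have "\<exists>c. \<forall>z\<in>ball a r. (\<lambda>n. c n * (z - a) ^ n) sums g z" if a: "a \<in> \<sigma>" for a
  proof -
    obtain c where "\<forall>z\<in>ball a r. (\<lambda>n. c n * (z - a) ^ n) sums f z"
      using assms(1) a unfolding BB_def by blast
    hence "\<forall>z\<in>ball a r. (\<lambda>n. c n * (z - a) ^ n) sums g z"
      using assms(2) ball_subset_DD[OF a] by (metis subsetD)
    thus ?thesis
      by blast
  qed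
  moreover have "\<exists>C. \<forall>z\<in>DD \<sigma> r. vabs (g z) \<le> C"
    using assms by (auto simp: BB_def)
  ultimately show ?thesis
    unfolding BB_def by blast
qed

lemma BB_add:
  assumes "f \<in> BB \<sigma> r" "g \<in> BB \<sigma> r"
  shows "(\<lambda>z. f z + g z) \<in> BB \<sigma> r"
proof -
  have "\<exists>c. \<forall>z\<in>ball a r. (\<lambda>n. c n * (z - a) ^ n) sums (f z + g z)" if a: "a \<in> \<sigma>" for a
  proof -
    obtain c d where "\<forall>z\<in>ball a r. (\<lambda>n. c n * (z - a) ^ n) sums f z"
        "\<forall>z\<in>ball a r. (\<lambda>n. d n * (z - a) ^ n) sums g z"
      using assms a unfolding BB_def by blast
    hence "\<forall>z\<in>ball a r. (\<lambda>n. (c n + d n) * (z - a) ^ n) sums (f z + g z)"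
      by (auto simp: distrib_right intro!: sums_add)
    thus ?thesis
      by (intro exI[of _ "\<lambda>n. c n + d n"])
  qed
  moreover obtain C D where "\<forall>z\<in>DD \<sigma> r. vabs (f z) \<le> C" "\<forall>z\<in>DD \<sigma> r. vabs (g z) \<le> D"
    using assms unfolding BB_def by blast
  hence "\<forall>z\<in>DD \<sigma> r. vabs (f z + g z) \<le> max C D"
    by (blast intro: vabs_add_le max.coboundedI1 max.coboundedI2)
  ultimately show ?thesis
    unfolding BB_def by blast
qed

text \<open>About a centre \<open>a\<close> the factor is \<open>(A + B * a) + B * (z - a)\<close>,
  so the product series is a scaled copy of the given one plus a copy shifted by one place.\<close>

lemma BB_mult_affine:
  assumes f: "f \<in> BB \<sigma> r" and bound: "\<And>z. z \<in> DD \<sigma> r \<Longrightarrow> vabs (A + B * z) \<le> K"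
  shows "(\<lambda>z. (A + B * z) * f z) \<in> BB \<sigma> r"
proof -
  have "\<exists>c. \<forall>z\<in>ball a r. (\<lambda>n. c n * (z - a) ^ n) sums ((A + B * z) * f z)" if a: "a \<in> \<sigma>" for a
  proof -
    obtain c where c: "\<forall>z\<in>ball a r. (\<lambda>n. c n * (z - a) ^ n) sums f z"
      using f a unfolding BB_def by blast
    \<comment> \<open>Coefficients of the shifted copy; nothing is contributed in degree 0.\<close>
    define d where "d n = (case n of 0 \<Rightarrow> 0 | Suc m \<Rightarrow> B * c m)" for n
    have "(\<lambda>n. ((A + B * a) * c n + d n) * (z - a) ^ n) sums ((A + B * z) * f z)" if z: "z \<in> ball a r" for z
    proof -
      have "(\<lambda>n. d (Suc n) * (z - a) ^ Suc n) sums (B * (z - a) * f z)"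
        using sums_mult_nonarch[OF c[rule_format, OF z], of "B * (z - a)"]
        by (simp add: d_def mult_ac)
      from sums_Suc[OF this] have "(\<lambda>n. d n * (z - a) ^ n) sums (B * (z - a) * f z)"
        by (simp add: d_def)
      from sums_add[OF sums_mult_nonarch[OF c[rule_format, OF z], of "A + B * a"] this] show ?thesis
        by (simp add: algebra_simps)
    qed
    thus ?thesis
      by (intro exI[of _ "\<lambda>n. (A + B * a) * c n + d n"]) auto
  qed
  moreover obtain C where C: "\<forall>z\<in>DD \<sigma> r. vabs (f z) \<le> C"
    using f unfolding BB_def by blast
  hence "vabs ((A + B * z) * f z) \<le> K * C" if "z \<in> DD \<sigma> r" for z
    using bound[OF that] that unfolding vabs_mult
    by (intro mult_mono) (auto intro: order_trans[OF vabs_nonneg])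
  hence "\<exists>C. \<forall>z\<in>DD \<sigma> r. vabs ((A + B * z) * f z) \<le> C"
    by blast
  ultimately show ?thesis
    unfolding BB_def by blast
qed

lemma BB_cmult: "f \<in> BB \<sigma> r \<Longrightarrow> (\<lambda>z. c * f z) \<in> BB \<sigma> r"
  using BB_mult_affine[of f \<sigma> r c 0 "vabs c"] by simp

lemma BB_norm_le:
  assumes "\<And>z. z \<in> DD \<sigma> r \<Longrightarrow> vabs (f z) \<le> C" "0 \<le> C"
  shows "BB_norm \<sigma> r f \<le> C"
  unfolding BB_norm_def using assms by (intro cSup_least) auto

lemma germ_in_LL: "r > 0 \<Longrightarrow> f \<in> BB \<sigma> r \<Longrightarrow> germ \<sigma> f \<in> LL \<sigma>"
  unfolding LL_def by auto

text \<open>A germ is in \<open>LL\<close> as soon as one representative is analytic; every other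
  representative agrees with that one on a smaller neighbourhood and is analytic there.\<close>

lemma germ_in_LL_D:
  assumes "germ \<sigma> f \<in> LL \<sigma>"
  shows "\<exists>r>0. f \<in> BB \<sigma> r"
proof -
  obtain r g where g: "r > 0" "g \<in> BB \<sigma> r" "germ \<sigma> f = germ \<sigma> g"
    using assms by (auto simp: LL_def)
  have "f \<in> germ \<sigma> g"
    using germ_self g(3) by blast
  then obtain r' where r': "r' > 0" "\<And>z. z \<in> DD \<sigma> r' \<Longrightarrow> f z = g z"
    by (auto simp: germ_def)
  have "g \<in> BB \<sigma> (min r r')"
    using BB_mono[OF g(2)] by simp
  hence "f \<in> BB \<sigma> (min r r')"
    by (rule BB_cong) (use r'(2) DD_mono[of "min r r'" r' \<sigma>] in force)
  thus ?thesis
    using g(1) r'(1) by (intro exI[of _ "min r r'"]) auto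
qed

lemma LL_lattice_LL: "LL_lattice \<sigma> (LL \<sigma>)"
  unfolding LL_lattice_def
proof (intro conjI allI impI)
  fix f g assume "germ \<sigma> f \<in> LL \<sigma> \<and> germ \<sigma> g \<in> LL \<sigma>"
  then obtain r s where rs: "r > 0" "f \<in> BB \<sigma> r" "s > 0" "g \<in> BB \<sigma> s"
    using germ_in_LL_D by metis
  have "(\<lambda>z. f z + g z) \<in> BB \<sigma> (min r s)"
    using rs by (intro BB_add) (auto elim: BB_mono)
  thus "germ \<sigma> (\<lambda>z. f z + g z) \<in> LL \<sigma>"
    using rs(1,3) by (intro germ_in_LL[of "min r s"]) simp_all
next
  fix c :: 'a and f assume "vabs c \<le> 1 \<and> germ \<sigma> f \<in> LL \<sigma>"
  then obtain r where "r > 0" "f \<in> BB \<sigma> r"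
    using germ_in_LL_D by blast
  thus "germ \<sigma> (\<lambda>z. c * f z) \<in> LL \<sigma>"
    by (intro germ_in_LL[of r] BB_cmult)
next
  fix r :: real assume "r > 0"
  thus "\<exists>e>0. \<forall>f\<in>BB \<sigma> r. BB_norm \<sigma> r f < e \<longrightarrow> germ \<sigma> f \<in> LL \<sigma>"
    by (intro exI[of _ 1]) (simp add: germ_in_LL)
qed simp

lemma topspace_LL_topology: "topspace (LL_topology \<sigma>) = LL \<sigma>"
proof
  have "LL_open \<sigma> (topspace (LL_topology \<sigma>))"
    by (simp flip: openin_LL_topology)
  thus "topspace (LL_topology \<sigma>) \<subseteq> LL \<sigma>"
    by (simp add: LL_open_def)
next
  have "\<forall>f g. germ \<sigma> f \<in> LL \<sigma> \<and> germ \<sigma> g \<in> LL \<sigma> \<longrightarrow> germ \<sigma> (\<lambda>z. f z + g z) \<in> LL \<sigma>"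
    using LL_lattice_LL[of \<sigma>] unfolding LL_lattice_def by (elim conjE)
  hence "LL_open \<sigma> (LL \<sigma>)"
    unfolding LL_open_def using LL_lattice_LL[of \<sigma>]
    by (intro conjI order_refl allI impI exI[of _ "LL \<sigma>"]) simp_all
  thus "LL \<sigma> \<subseteq> topspace (LL_topology \<sigma>)"
    by (simp add: openin_LL_topology openin_subset)
qed

section \<open>Integration against generalized distributions\<close>

lemma dist_integral_cong:
  assumes "r > 0" "\<And>z. z \<in> DD \<sigma> r \<Longrightarrow> f z = g z"
  shows "dist_integral \<sigma> \<mu> f = dist_integral \<sigma> \<mu> g"
  using germ_cong[OF assms] by (simp add: dist_integral_def)

lemma dist_integral_add:
  assumes "\<mu> \<in> LL_dual \<sigma>" "r > 0" "f \<in> BB \<sigma> r" "g \<in> BB \<sigma> r"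
  shows "dist_integral \<sigma> \<mu> (\<lambda>z. f z + g z) = dist_integral \<sigma> \<mu> f + dist_integral \<sigma> \<mu> g"
  using assms germ_in_LL unfolding dist_integral_def LL_dual_def by blast

lemma dist_integral_cmult:
  assumes "\<mu> \<in> LL_dual \<sigma>" "r > 0" "f \<in> BB \<sigma> r"
  shows "dist_integral \<sigma> \<mu> (\<lambda>z. c * f z) = c * dist_integral \<sigma> \<mu> f"
  using assms germ_in_LL unfolding dist_integral_def LL_dual_def by blast

text \<open>Continuity in the form in which it is applied: the preimage of a ball is open and
  contains the zero germ, hence contains a lattice, and a lattice absorbs a norm ball of every
  \<open>BB \<sigma> r\<close>.\<close>

lemma dist_integral_small:
  assumes \<mu>: "\<mu> \<in> LL_dual \<sigma>" and r: "r > 0" and e: "e > 0"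
  shows "\<exists>d>0. \<forall>f\<in>BB \<sigma> r. BB_norm \<sigma> r f < d \<longrightarrow> vabs (dist_integral \<sigma> \<mu> f) < e"
proof -
  have zero: "(\<lambda>_. 0) \<in> BB \<sigma> r"
    unfolding BB_def by (auto intro!: exI[of _ "\<lambda>_. 0"] exI[of _ 0])
  hence "\<mu> (germ \<sigma> (\<lambda>_. 0)) = 0"
    using dist_integral_cmult[OF \<mu> r zero, of 0] by (simp add: dist_integral_def)
  define U where "U = {x \<in> LL \<sigma>. \<mu> x \<in> ball 0 e}"
  have "continuous_map (LL_topology \<sigma>) euclidean \<mu>"
    using \<mu> by (simp add: LL_dual_def)
  hence "openin (LL_topology \<sigma>) U"
    using openin_continuous_map_preimage[of "LL_topology \<sigma>" euclidean \<mu> "ball 0 e"]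
    by (simp add: U_def topspace_LL_topology)
  hence "LL_open \<sigma> U"
    by (simp add: openin_LL_topology)
  moreover have "germ \<sigma> (\<lambda>_. 0) \<in> U"
    using \<open>\<mu> (germ \<sigma> (\<lambda>_. 0)) = 0\<close> e germ_in_LL[OF r zero] by (simp add: U_def)
  ultimately obtain V where V: "LL_lattice \<sigma> V" "\<forall>g. germ \<sigma> g \<in> V \<longrightarrow> germ \<sigma> (\<lambda>z. 0 + g z) \<in> U"
    unfolding LL_open_def by blast
  then obtain d where d: "d > 0" "\<forall>f\<in>BB \<sigma> r. BB_norm \<sigma> r f < d \<longrightarrow> germ \<sigma> f \<in> V"
    using r unfolding LL_lattice_def by blast
  have "vabs (dist_integral \<sigma> \<mu> f) < e" if "f \<in> BB \<sigma> r" "BB_norm \<sigma> r f < d" for f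
    using d(2) V(2) that by (auto simp: U_def dist_integral_def dist_vabs)
  thus ?thesis
    using d(1) by blast
qed

lemma padic_deriv_eqI:
  assumes "has_padic_deriv f D S a" "at a within S \<noteq> bot"
  shows "padic_deriv f S a = D"
  unfolding padic_deriv_def
proof (rule the_equality)
  show "has_padic_deriv f D S a"
    by fact
next
  fix D' assume "has_padic_deriv f D' S a"
  thus "D' = D"
    using assms(1) unfolding has_padic_deriv_def by (rule tendsto_unique[OF assms(2)])
qed

section \<open>Binomial series and logarithm as analytic functions, and differentiation under the
  integral\<close>

context padic_field
begin

lemma vabs_one_plus_pow_le_one:
  assumes "s \<in> (Zp :: 'c set)" "vabs t < 1"
  shows "vabs (one_plus_pow s t) \<le> 1"
proof -
  have "vabs ((s gchoose n) * t ^ n) \<le> 1" for n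
    using assms by (intro vabs_mult_le_one vabs_gchoose_le_one) (simp_all add: vabs_power power_le_one)
  thus ?thesis
    by (rule vabs_sums_le[OF one_plus_pow_sums[OF assms]])
qed

text \<open>Multiplicativity gives the expansion around a new centre:
  \<open>1 + w + v = (1 + w) (1 + v / (1 + w))\<close>.\<close>

lemma recentre:
  assumes "vabs (w :: 'c) < 1" "vabs (w + v) < 1"
  shows "w + v = w + v / (1 + w) + w * (v / (1 + w))" "vabs (v / (1 + w)) < 1"
proof -
  have w: "vabs (1 + w) = 1"
    using vabs_one_plus assms(1) .
  hence "1 + w \<noteq> 0"
    by auto
  hence "(1 + w) * (v / (1 + w)) = v"
    by simp
  thus "w + v = w + v / (1 + w) + w * (v / (1 + w))"
    by (metis add.assoc distrib_right mult_1)
  have "vabs v < 1"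
    using vabs_diff_less[OF assms(2,1)] by simp
  thus "vabs (v / (1 + w)) < 1"
    by (simp add: vabs_divide w)
qed

lemma one_plus_pow_in_BB:
  assumes s: "s \<in> (Zp :: 'c set)" and small: "\<And>z. z \<in> DD \<sigma> r \<Longrightarrow> vabs (A + B * z) < 1"
  shows "(\<lambda>z. one_plus_pow s (A + B * z)) \<in> BB \<sigma> r"
proof -
  have "\<exists>c. \<forall>z\<in>ball a r. (\<lambda>n. c n * (z - a) ^ n) sums one_plus_pow s (A + B * z)" if a: "a \<in> \<sigma>" for a
  proof -
    \<comment> \<open>The increment at the centre; \<open>B * (z - a)\<close> plays the role of
      \<open>v\<close> in \<open>recentre\<close>.\<close>
    define w where "w = A + B * a"
    have "(\<lambda>n. one_plus_pow s w * (s gchoose n) * (B / (1 + w)) ^ n * (z - a) ^ n) sums one_plus_pow s (A + B * z)"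
      if z: "z \<in> ball a r" for z
    proof -
      have "r > 0"
        using z by (metis ball_eq_empty empty_iff not_less)
      hence w1: "vabs w < 1"
        using small[of a] ball_subset_DD[OF a, of r] unfolding w_def by force
      have eq: "w + B * (z - a) = A + B * z"
        by (simp add: w_def algebra_simps)
      have "vabs (w + B * (z - a)) < 1"
        unfolding eq using small z ball_subset_DD[OF a] by blast
      note rc = recentre[OF w1 this]
      have "one_plus_pow s (A + B * z) = one_plus_pow s w * one_plus_pow s (B * (z - a) / (1 + w))"
        unfolding eq[symmetric] by (subst rc(1)) (rule one_plus_pow_mult[OF s w1 rc(2)])
      thus ?thesis
        using sums_mult_nonarch[OF one_plus_pow_sums[OF s rc(2)], of "one_plus_pow s w"]
        by (simp add: power_mult_distrib power_divide mult_ac)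
    qed
    thus ?thesis
      by (intro exI[of _ "\<lambda>n. one_plus_pow s w * (s gchoose n) * (B / (1 + w)) ^ n"]) blast
  qed
  moreover have "\<exists>C. \<forall>z\<in>DD \<sigma> r. vabs (one_plus_pow s (A + B * z)) \<le> C"
    using vabs_one_plus_pow_le_one[OF s small] by blast
  ultimately show ?thesis
    unfolding BB_def by blast
qed

text \<open>Unlike the power, the logarithm is unbounded on the open unit disc, so the increments
  must stay below some \<open>\<rho> < 1\<close>; then the terms of the series have a common
  bound.\<close>

lemma log_one_plus_in_BB:
  assumes small: "\<And>z :: 'c. z \<in> DD \<sigma> r \<Longrightarrow> vabs (A + B * z) \<le> \<rho>" and \<rho>: "0 \<le> \<rho>" "\<rho> < 1"
  shows "(\<lambda>z. log_one_plus (A + B * z)) \<in> BB \<sigma> r"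
proof -
  have "\<exists>c. \<forall>z\<in>ball a r. (\<lambda>n. c n * (z - a) ^ n) sums log_one_plus (A + B * z)" if a: "a \<in> \<sigma>" for a
  proof -
    define w where "w = A + B * a"
    \<comment> \<open>The logarithm turns the product of \<open>recentre\<close> into a sum: the
      value at the centre is the constant term, and the rest is the series in
      \<open>B * (z - a) / (1 + w)\<close>.\<close>
    define c where "c n = (case n of 0 \<Rightarrow> log_one_plus w
        | Suc m \<Rightarrow> (-1) ^ m * (B / (1 + w)) ^ Suc m / of_nat (Suc m))" for n
    have "(\<lambda>n. c n * (z - a) ^ n) sums log_one_plus (A + B * z)" if z: "z \<in> ball a r" for z
    proof -
      have "r > 0"
        using z by (metis ball_eq_empty empty_iff not_less)
      hence w1: "vabs w < 1"
        using small[of a] ball_subset_DD[OF a, of r] \<rho> unfolding w_def by force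
      have eq: "w + B * (z - a) = A + B * z"
        by (simp add: w_def algebra_simps)
      have "vabs (w + B * (z - a)) < 1"
        unfolding eq using small[of z] z ball_subset_DD[OF a, of r] \<rho> by force
      note rc = recentre[OF w1 this]
      have "log_one_plus (A + B * z) = log_one_plus w + log_one_plus (B * (z - a) / (1 + w))"
        unfolding eq[symmetric] by (subst rc(1)) (rule log_one_plus_mult[OF w1 rc(2)])
      moreover have "(\<lambda>n. c (Suc n) * (z - a) ^ Suc n) sums log_one_plus (B * (z - a) / (1 + w))"
        using log_one_plus_sums[OF rc(2)]
        by (simp add: c_def power_mult_distrib power_divide mult_ac)
      from sums_Suc[OF this] have "(\<lambda>n. c n * (z - a) ^ n) sums (log_one_plus (B * (z - a) / (1 + w)) + log_one_plus w)"
        by (simp add: c_def)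
      ultimately show ?thesis
        by (simp add: add.commute)
    qed
    thus ?thesis
      by blast
  qed
  moreover have "\<exists>C. \<forall>z\<in>DD \<sigma> r. vabs (log_one_plus (A + B * z)) \<le> C"
  proof -
    have "Bseq (\<lambda>n. real (Suc n) * \<rho> ^ Suc n)"
      using log_bound_tendsto[OF \<rho>] by (intro convergent_imp_Bseq convergentI)
    then obtain C where "\<forall>n. norm (real (Suc n) * \<rho> ^ Suc n) \<le> C"
      by (rule BseqE)
    hence C: "\<bar>real (Suc n) * \<rho> ^ Suc n\<bar> \<le> C" for n
      by (simp only: real_norm_def)
    have "vabs (log_one_plus (A + B * z)) \<le> C" if z: "z \<in> DD \<sigma> r" for z
    proof -
      have "vabs ((-1) ^ n * (A + B * z) ^ Suc n / of_nat (Suc n)) \<le> C" for n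
        using vabs_log_term_le[OF small[OF z], of "(-1) ^ n" n] C[of n]
        by (simp add: vabs_power del: of_nat_Suc power_Suc)
      moreover have "vabs (A + B * z) < 1"
        using small[OF z] \<rho> by linarith
      ultimately show ?thesis
        using vabs_sums_le[OF log_one_plus_sums] by blast
    qed
    thus ?thesis
      by blast
  qed
  ultimately show ?thesis
    unfolding BB_def by blast
qed

lemma times_log_one_plus_in_BB:
  assumes small: "\<And>z :: 'c. z \<in> DD \<sigma> r \<Longrightarrow> vabs (A + B * z) \<le> \<rho>" and \<rho>: "0 \<le> \<rho>" "\<rho> < 1"
  shows "(\<lambda>z. (1 + (A + B * z)) * log_one_plus (A + B * z)) \<in> BB \<sigma> r"
proof -
  have "(\<lambda>z. ((1 + A) + B * z) * log_one_plus (A + B * z)) \<in> BB \<sigma> r"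
  proof (rule BB_mult_affine[OF log_one_plus_in_BB[OF small \<rho>]])
    fix z assume "z \<in> DD \<sigma> r"
    hence "vabs (A + B * z) < 1"
      using small[of z] \<rho> by linarith
    thus "vabs ((1 + A) + B * z) \<le> 1"
      using vabs_one_plus[of "A + B * z"] by (simp add: add.assoc)
  qed
  thus ?thesis
    by (simp add: add.assoc)
qed

text \<open>The error of the difference quotient is \<open>1 + t\<close>, of absolute value 1, times
  the error estimated uniformly in \<open>one_plus_pow_deriv\<close> at \<open>- s\<close>. It is
  thus small in the norm of \<open>BB \<sigma> r\<close>, and \<open>dist_integral_small\<close>
  carries this over to the integrals.\<close>

lemma dist_integral_one_plus_pow_deriv:
  assumes \<mu>: "\<mu> \<in> LL_dual \<sigma>" and r: "r > 0"
    and small: "\<And>z :: 'c. z \<in> DD \<sigma> r \<Longrightarrow> vabs (A + B * z) \<le> \<rho>" and \<rho>: "0 \<le> \<rho>" "\<rho> < 1"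
  shows "has_padic_deriv (\<lambda>s. dist_integral \<sigma> \<mu> (\<lambda>z. one_plus_pow (1 - s) (A + B * z)))
     (- dist_integral \<sigma> \<mu> (\<lambda>z. (1 + (A + B * z)) * log_one_plus (A + B * z))) Zp 0"
proof -
  let ?t = "\<lambda>z. A + B * z"
  define g where "g = (\<lambda>z. (1 + ?t z) * log_one_plus (?t z))"
  define G where "G = (\<lambda>s. dist_integral \<sigma> \<mu> (\<lambda>z. one_plus_pow (1 - s) (?t z)))"
  \<comment> \<open>Difference quotient minus its expected limit \<open>- g\<close>, spelled as a
    linear combination so that linearity of the integral applies term by term.\<close>
  define h where "h = (\<lambda>s z. inverse s * one_plus_pow (1 - s) (?t z) + (- inverse s) * one_plus_pow (1 - 0) (?t z) + g z)"
  have small1: "vabs (?t z) < 1" if "z \<in> DD \<sigma> r" for z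
    using small[OF that] \<rho> by linarith
  have Zp1: "1 - s \<in> Zp" if "s \<in> (Zp :: 'c set)" for s
    using Zp_diff[OF of_nat_in_Zp[of 1] that] by simp
  have Zp0: "- s \<in> Zp" if "s \<in> (Zp :: 'c set)" for s
    using Zp_diff[OF of_nat_in_Zp[of 0] that] by simp
  have g: "g \<in> BB \<sigma> r"
    unfolding g_def by (rule times_log_one_plus_in_BB[OF small \<rho>])
  have f: "(\<lambda>z. one_plus_pow (1 - s) (?t z)) \<in> BB \<sigma> r" if "s \<in> Zp" for s
    by (intro one_plus_pow_in_BB Zp1 that small1)
  have hBB: "h s \<in> BB \<sigma> r" if "s \<in> Zp" for s
    unfolding h_def using of_nat_in_Zp[of 0] by (intro BB_add BB_cmult f g that) simp
  have h_int: "dist_integral \<sigma> \<mu> (h s) = (G s - G 0) / s + dist_integral \<sigma> \<mu> g" if "s \<in> Zp" for s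
  proof -
    have 0: "0 \<in> (Zp :: 'c set)"
      using of_nat_in_Zp[of 0] by simp
    have "dist_integral \<sigma> \<mu> (h s) = inverse s * G s + (- inverse s) * G 0 + dist_integral \<sigma> \<mu> g"
      unfolding h_def G_def
      by (simp only: dist_integral_add[OF \<mu> r] dist_integral_cmult[OF \<mu> r] BB_add BB_cmult f[OF that] f[OF 0] g)
    thus ?thesis
      by (simp add: divide_inverse algebra_simps)
  qed
  have h_eq: "h s z = - (1 + ?t z) * ((one_plus_pow (- s) (?t z) - 1) / (- s) - log_one_plus (?t z))"
    if "s \<in> Zp" "s \<noteq> 0" "z \<in> DD \<sigma> r" for s z
  proof -
    have "one_plus_pow (1 - s) (?t z) = (1 + ?t z) * one_plus_pow (- s) (?t z)"
      using one_plus_pow_Suc[OF Zp0[OF that(1)] small1[OF that(3)]] by simp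
    moreover have "one_plus_pow (1 - 0) (?t z) = 1 + ?t z"
      using one_plus_pow_of_nat[of 1 "?t z"] by simp
    ultimately show ?thesis
      unfolding h_def g_def using that(2) by (simp only:) (simp add: field_simps)
  qed
  have neg: "filterlim uminus (at (0 :: 'c) within Zp) (at 0 within Zp)"
    unfolding filterlim_at
  proof (intro conjI)
    show "\<forall>\<^sub>F s in at (0 :: 'c) within Zp. - s \<in> Zp \<and> - s \<noteq> 0"
      using Zp0 by (simp add: eventually_at_filter)
    show "(uminus \<longlongrightarrow> (0 :: 'c)) (at 0 within Zp)"
      using tendsto_minus[OF tendsto_ident_at, of "0 :: 'c" Zp] by simp
  qed
  have "((\<lambda>s. (G s - G 0) / s) \<longlongrightarrow> - dist_integral \<sigma> \<mu> g) (at 0 within Zp)"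
    unfolding tendsto_vabs_iff
  proof (rule order_tendstoI)
    fix e :: real assume "e > 0"
    then obtain d where d: "d > 0"
        "\<And>f. f \<in> BB \<sigma> r \<Longrightarrow> BB_norm \<sigma> r f < d \<Longrightarrow> vabs (dist_integral \<sigma> \<mu> f) < e"
      using dist_integral_small[OF \<mu> r] by blast
    \<comment> \<open>A supremum only inherits the weak inequality, whereas the norm has to be
      strictly below \<open>d\<close>; hence \<open>d / 2\<close>.\<close>
    have "\<forall>\<^sub>F s in at 0 within (Zp :: 'c set).
           \<forall>t. vabs t \<le> \<rho> \<longrightarrow> vabs ((one_plus_pow s t - 1) / s - log_one_plus t) \<le> d / 2"
      using one_plus_pow_deriv[OF \<rho>, of "d / 2"] d(1) by simp
    from eventually_compose_filterlim[OF this neg]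
    have "\<forall>\<^sub>F s in at 0 within (Zp :: 'c set).
           \<forall>t. vabs t \<le> \<rho> \<longrightarrow> vabs ((one_plus_pow (- s) t - 1) / (- s) - log_one_plus t) \<le> d / 2" .
    moreover have "\<forall>\<^sub>F s in at (0 :: 'c) within Zp. s \<in> Zp \<and> s \<noteq> 0"
      by (simp add: eventually_at_filter)
    ultimately show "\<forall>\<^sub>F s in at 0 within Zp. vabs ((G s - G 0) / s - - dist_integral \<sigma> \<mu> g) < e"
    proof eventually_elim
      case (elim s)
      have "vabs (h s z) \<le> d / 2" if z: "z \<in> DD \<sigma> r" for z
      proof -
        have "vabs (- (1 + ?t z)) = 1"
          using vabs_one_plus[OF small1[OF z]] by (simp only: vabs_minus)
        hence "vabs (h s z) = vabs ((one_plus_pow (- s) (?t z) - 1) / (- s) - log_one_plus (?t z))"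
          using elim by (subst h_eq[OF _ _ z]) (auto simp only: vabs_mult mult_1)
        thus ?thesis
          using elim small[OF z] by metis
      qed
      hence "BB_norm \<sigma> r (h s) \<le> d / 2"
        using d(1) by (intro BB_norm_le) auto
      hence "vabs (dist_integral \<sigma> \<mu> (h s)) < e"
        using d hBB elim by auto
      thus ?case
        using h_int elim by simp
    qed
  qed (auto intro!: always_eventually elim: less_le_trans)
  thus ?thesis
    by (simp add: has_padic_deriv_def G_def g_def)
qed

end

text \<open>The product rule for a factor with value and derivative \<open>-1\<close> at 0. It rests
  on the identity that the difference quotient of the product is
  \<open>1 / (s - 1) * ((G s - G 0) / s + G 0)\<close>.\<close>

lemma has_padic_deriv_times_inverse:
  fixes G :: "'c::complete_nonarch_field \<Rightarrow> 'c"
  assumes "has_padic_deriv G D S 0"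
  shows "has_padic_deriv (\<lambda>s. 1 / (s - 1) * G s) (- D - G 0) (S - {1}) 0"
  unfolding has_padic_deriv_def
proof (rule Lim_transform_eventually)
  let ?F = "at 0 within (S - {1})"
  have id: "((\<lambda>s. s) \<longlongrightarrow> 0) ?F"
    by (rule tendsto_ident_at)
  have inv: "((\<lambda>s. 1 / (s - 1)) \<longlongrightarrow> - 1) ?F"
  proof (rule tendstoI_vabs_bound)
    show "((\<lambda>s :: 'c. vabs s) \<longlongrightarrow> 0) ?F"
      using tendsto_vabs[OF id] by simp
    hence "\<forall>\<^sub>F s in ?F. vabs s < 1"
      by (rule order_tendstoD) simp
    thus "\<forall>\<^sub>F s in ?F. vabs (1 / (s - 1) - - 1) \<le> vabs s"
    proof eventually_elim
      case (elim s)
      hence 1: "vabs (s - 1) = 1"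
        using vabs_one_plus[of "- s"] by (simp add: vabs_minus_commute)
      hence "s - 1 \<noteq> 0"
        by (metis vabs_zero zero_neq_one)
      hence "1 / (s - 1) - - 1 = s / (s - 1)"
        by (simp add: field_simps)
      thus ?case
        using 1 by (simp add: vabs_divide)
    qed
  qed
  have "((\<lambda>s. (G s - G 0) / s) \<longlongrightarrow> D) ?F"
    using assms unfolding has_padic_deriv_def diff_zero
    by (rule tendsto_within_subset) auto
  from tendsto_mult[OF inv tendsto_add[OF this tendsto_const[of "G 0"]]]
  show "((\<lambda>s. 1 / (s - 1) * ((G s - G 0) / s + G 0)) \<longlongrightarrow> - D - G 0) ?F"
    by simp
  have "\<forall>\<^sub>F s in ?F. s \<noteq> 0 \<and> s \<noteq> 1"
    by (simp add: eventually_at_filter)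
  thus "\<forall>\<^sub>F s in ?F. 1 / (s - 1) * ((G s - G 0) / s + G 0)
          = (1 / (s - 1) * G s - 1 / (0 - 1) * G 0) / (s - 0)"
  proof eventually_elim
    case (elim s)
    hence "s - 1 \<noteq> 0"
      by simp
    thus ?case
      using elim by (simp add: divide_simps) (simp add: algebra_simps)
  qed
qed

section \<open>Derivatives of the zeta functions and the integral formulas\<close>

context Cp_powers
begin

text \<open>Since \<open>angle p ppow (lam + z)\<close> is \<open>1 + (A + B * z)\<close> on
  \<open>DD \<sigma> 1\<close>, the derivative under the integral applies. Multiplication by
  \<open>\<omega>\<close> turns \<open>1 + (A + B * z)\<close> into \<open>lam + z\<close>, and
  \<open>1 / (s - 1)\<close> contributes \<open>- G 0\<close>, the integral of
  \<open>- (1 + (A + B * z))\<close>, which becomes the \<open>-1\<close> next to the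
  logarithm.\<close>

lemma
  assumes bound: "\<And>z :: 'c. z \<in> DD \<sigma> 1 \<Longrightarrow> vabs z \<le> R" and lam: "R < vabs lam" "0 \<le> R"
    and \<mu>: "\<mu> \<in> LL_dual \<sigma>"
  shows zeta_has_padic_deriv: "\<exists>D. has_padic_deriv (\<lambda>s. zeta p ppow \<sigma> \<mu> s lam) D (Zp - {1}) 0"
    and log_Gamma_eq: "log_Gamma p ppow \<sigma> \<mu> lam =
      dist_integral \<sigma> \<mu> (\<lambda>x. (lam + x) * (iwasawa_log p (lam + x) - 1))"
    and zeta_E_has_padic_deriv: "\<exists>D. has_padic_deriv (\<lambda>s. zeta_E p ppow \<sigma> \<mu> s lam) D Zp 0"
    and log_Gamma_E_eq: "log_Gamma_E p ppow \<sigma> \<mu> lam =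
      - dist_integral \<sigma> \<mu> (\<lambda>x. (lam + x) * iwasawa_log p (lam + x))"
proof -
  define \<omega> where "\<omega> = omega_v p ppow lam"
  define A where "A = lam / \<omega> - 1"
  define B where "B = 1 / \<omega>"
  \<comment> \<open>\<open>A\<close> is \<open>angle p ppow lam - 1\<close>, hence below 1, and
    \<open>R / vabs lam\<close> bounds \<open>B * z\<close> because \<open>\<omega>\<close> has the
    absolute value of \<open>lam\<close>.\<close>
  define \<rho> where "\<rho> = max (vabs A) (R / vabs lam)"
  define g where "g = (\<lambda>z. (1 + (A + B * z)) * log_one_plus (A + B * z))"
  define G where "G = (\<lambda>s. dist_integral \<sigma> \<mu> (\<lambda>z. one_plus_pow (1 - s) (A + B * z)))"
  have lam0: "lam \<noteq> 0"
    using lam by auto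
  have \<omega>0: "\<omega> \<noteq> 0"
    unfolding \<omega>_def by (rule omega_v_nonzero[OF lam0])
  have A1: "vabs A < 1"
    using vabs_angle_minus_one[OF lam0] by (simp add: A_def \<omega>_def angle_def)
  have "vabs (lam / \<omega>) = 1"
    using vabs_one_plus[OF A1] by (simp add: A_def)
  hence v\<omega>: "vabs \<omega> = vabs lam"
    using \<omega>0 by (simp add: vabs_divide)
  have \<rho>: "0 \<le> \<rho>" "\<rho> < 1"
    using A1 lam lam0 by (auto simp: \<rho>_def le_max_iff_disj)
  have small: "vabs (A + B * z) \<le> \<rho>" if "z \<in> DD \<sigma> 1" for z
  proof -
    have "vabs (B * z) \<le> R / vabs lam"
      using bound[OF that] by (simp add: B_def vabs_divide v\<omega> divide_right_mono)
    thus ?thesis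
      using vabs_add[of A "B * z"] by (simp add: \<rho>_def)
  qed
  have nz: "lam + z \<noteq> 0" and angle: "angle p ppow (lam + z) - 1 = A + B * z" if "z \<in> DD \<sigma> 1" for z
  proof -
    have "vabs ((lam + z) - lam) < vabs lam"
      using bound[OF that] lam by simp
    note close = omega_v_close[OF this] vabs_eq_of_close[OF this]
    show "lam + z \<noteq> 0"
      using close(2) lam0 by auto
    show "angle p ppow (lam + z) - 1 = A + B * z"
      using close(1) by (simp add: angle_def A_def B_def \<omega>_def add_divide_distrib)
  qed
  have \<omega>t: "\<omega> * (1 + (A + B * z)) = lam + z" for z
    using \<omega>0 by (simp add: A_def B_def distrib_left)
  have log: "iwasawa_log p (lam + z) = log_one_plus (A + B * z)" if "z \<in> DD \<sigma> 1" for z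
    using iwasawa_log_eq[OF nz[OF that]] angle[OF that] by simp
  have zeta_E: "zeta_E p ppow \<sigma> \<mu> s lam = G s" for s
    unfolding zeta_E_def G_def by (rule dist_integral_cong[of 1]) (simp_all add: angle_pow_def angle one_plus_pow_def)
  have zeta: "zeta p ppow \<sigma> \<mu> s lam = 1 / (s - 1) * G s" for s
    using zeta_E[of s] by (simp only: zeta_def zeta_E_def)
  have DE: "has_padic_deriv (\<lambda>s. zeta_E p ppow \<sigma> \<mu> s lam) (- dist_integral \<sigma> \<mu> g) Zp 0"
    unfolding zeta_E unfolding G_def g_def
    by (rule dist_integral_one_plus_pow_deriv[OF \<mu> zero_less_one small \<rho>])
  hence D: "has_padic_deriv (\<lambda>s. zeta p ppow \<sigma> \<mu> s lam) (- (- dist_integral \<sigma> \<mu> g) - G 0) (Zp - {1}) 0"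
    unfolding zeta_E zeta by (rule has_padic_deriv_times_inverse)
  show "\<exists>D. has_padic_deriv (\<lambda>s. zeta p ppow \<sigma> \<mu> s lam) D (Zp - {1}) 0"
    using D by blast
  show "\<exists>D. has_padic_deriv (\<lambda>s. zeta_E p ppow \<sigma> \<mu> s lam) D Zp 0"
    using DE by blast
  have gBB: "g \<in> BB \<sigma> 1"
    unfolding g_def by (rule times_log_one_plus_in_BB[OF small \<rho>])
  have "vabs (A + B * z) < 1" if "z \<in> DD \<sigma> 1" for z
    using small[OF that] \<rho> by linarith
  hence fBB: "(\<lambda>z. one_plus_pow (1 - 0) (A + B * z)) \<in> BB \<sigma> 1"
    using of_nat_in_Zp[of 1] by (intro one_plus_pow_in_BB) simp_all
  have f: "one_plus_pow (1 - 0) t = 1 + t" for t :: 'c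
    using one_plus_pow_of_nat[of 1 t] by simp
  have "log_Gamma_E p ppow \<sigma> \<mu> lam = - (\<omega> * dist_integral \<sigma> \<mu> g)"
    using padic_deriv_eqI[OF DE zero_limit_point_Zp(2)] by (simp add: log_Gamma_E_def \<omega>_def)
  also have "\<omega> * dist_integral \<sigma> \<mu> g = dist_integral \<sigma> \<mu> (\<lambda>z. \<omega> * g z)"
    by (rule dist_integral_cmult[OF \<mu> _ gBB, symmetric]) simp
  also have "\<dots> = dist_integral \<sigma> \<mu> (\<lambda>x. (lam + x) * iwasawa_log p (lam + x))"
    by (rule dist_integral_cong[of 1]) (simp_all add: g_def log \<omega>t flip: mult.assoc)
  finally show "log_Gamma_E p ppow \<sigma> \<mu> lam =
      - dist_integral \<sigma> \<mu> (\<lambda>x. (lam + x) * iwasawa_log p (lam + x))" .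
  have "log_Gamma p ppow \<sigma> \<mu> lam = \<omega> * dist_integral \<sigma> \<mu> g + (- \<omega>) * G 0"
    unfolding log_Gamma_def padic_deriv_eqI[OF D zero_limit_point_Zp(1)] \<omega>_def[symmetric]
    by (simp add: algebra_simps)
  also have "\<dots> = dist_integral \<sigma> \<mu> (\<lambda>z. \<omega> * g z + (- \<omega>) * one_plus_pow (1 - 0) (A + B * z))"
    unfolding G_def using zero_less_one[where ?'a = real]
    by (simp only: dist_integral_add[OF \<mu>, of 1] dist_integral_cmult[OF \<mu>, of 1] BB_cmult gBB fBB)
  also have "\<dots> = dist_integral \<sigma> \<mu> (\<lambda>x. (lam + x) * (iwasawa_log p (lam + x) - 1))"
  proof (rule dist_integral_cong[of 1])
    fix z assume z: "z \<in> DD \<sigma> 1"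
    have "\<omega> * g z + (- \<omega>) * one_plus_pow (1 - 0) (A + B * z)
        = \<omega> * (1 + (A + B * z)) * (log_one_plus (A + B * z) - 1)"
      unfolding g_def f by (simp add: algebra_simps)
    thus "\<omega> * g z + (- \<omega>) * one_plus_pow (1 - 0) (A + B * z) = (lam + z) * (iwasawa_log p (lam + z) - 1)"
      by (simp only: \<omega>t log[OF z])
  qed simp
  finally show "log_Gamma p ppow \<sigma> \<mu> lam =
      dist_integral \<sigma> \<mu> (\<lambda>x. (lam + x) * (iwasawa_log p (lam + x) - 1))" .
qed

end

theorem theorem4p3:
  fixes p :: nat
    and ppow :: "rat \<Rightarrow> 'c::complete_nonarch_field"
    and \<sigma> :: "'c set"
    and \<mu> \<nu> :: "('c \<Rightarrow> 'c) set \<Rightarrow> 'c"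
  assumes "prime p" and "odd p"
    and "is_Cp p TYPE('c)"
    and "fractional_powers p ppow"
    and "compact \<sigma>"
    and "\<mu> \<in> LL_dual \<sigma>" and "\<nu> \<in> LL_dual \<sigma>"
  shows "\<exists>R::real. \<forall>lam::'c. vabs lam > R \<and> (\<forall>x\<in>\<sigma>. lam + x \<noteq> 0) \<longrightarrow>
     (\<exists>D. has_padic_deriv (\<lambda>s. zeta p ppow \<sigma> \<mu> s lam) D (Zp - {1}) 0) \<and>
     log_Gamma p ppow \<sigma> \<mu> lam =
       dist_integral \<sigma> \<mu> (\<lambda>x. (lam + x) * (iwasawa_log p (lam + x) - 1)) \<and>
     (\<exists>D. has_padic_deriv (\<lambda>s. zeta_E p ppow \<sigma> \<nu> s lam) D Zp 0) \<and>
     log_Gamma_E p ppow \<sigma> \<nu> lam =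
       - dist_integral \<sigma> \<nu> (\<lambda>x. (lam + x) * iwasawa_log p (lam + x))"
proof -
  interpret Cp_powers p "TYPE('c)" ppow
    using assms by unfold_locales (simp_all add: is_Cp_def)
  obtain M where M: "\<And>x. x \<in> \<sigma> \<Longrightarrow> vabs x \<le> M"
    using compact_imp_bounded[OF assms(5)] unfolding bounded_any_center[where a = 0]
    by (auto simp: dist_vabs)
  \<comment> \<open>Points of \<open>DD \<sigma> 1\<close> lie at distance below 1 from
    \<open>\<sigma>\<close>, so they are bounded by the larger of \<open>M\<close> and 1. The
    maximum also keeps \<open>R\<close> nonnegative when \<open>\<sigma>\<close> is empty and
    \<open>M\<close> arbitrary.\<close>
  define R where "R = max M 1"
  have bound: "vabs z \<le> R" if z: "z \<in> DD \<sigma> 1" for z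
  proof -
    obtain a where a: "a \<in> \<sigma>" "z \<in> ball a 1"
      using z unfolding DD_def by blast
    have "vabs (z - a) < 1"
      using a(2) ball_vabs by blast
    thus ?thesis
      using vabs_add[of "z - a" a] M[OF a(1)] by (auto simp: R_def)
  qed
  have "0 \<le> R"
    by (simp add: R_def le_max_iff_disj)
  show ?thesis
    using zeta_has_padic_deriv[OF bound _ \<open>0 \<le> R\<close> assms(6)] log_Gamma_eq[OF bound _ \<open>0 \<le> R\<close> assms(6)]
      zeta_E_has_padic_deriv[OF bound _ \<open>0 \<le> R\<close> assms(7)] log_Gamma_E_eq[OF bound _ \<open>0 \<le> R\<close> assms(7)]
    by (intro exI[of _ R] allI impI conjI) auto
qed

end
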